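(* Let $V\subseteq\mathcal V$ be finite and $\mathbb E,\mathbb F\in\mathit{NProg}(V)$. Then: (1) $\mathbb E\le_T^s\mathbb F$ iff $\mathbb E\le_S\mathbb F$ iff ${\uparrow}\mathbb F\subseteq{\uparrow}\mathbb E$; (2) $\mathbb E\le_P^s\mathbb F$ iff $\mathbb F\le_H\mathbb E$ iff ${\downarrow}\mathbb F\subseteq{\downarrow}\mathbb E$; (3) $\mathbb E\le_{EM}\mathbb F$ iff both $\mathbb E\le_T^s\mathbb F$ and $\mathbb F\le_P^s\mathbb E$; (4) $\mathbb E\equiv_T^s\mathbb F$ iff ${\uparrow}\mathbb E={\uparrow}\mathbb F$, and $\mathbb E\equiv_P^s\mathbb F$ iff ${\downarrow}\mathbb E={\downarrow}\mathbb F$; (5) if $\mathbb E$ and $\mathbb F$ contain only trace-preserving super-operators, then $\mathbb E\le_T^s\mathbb F$ iff $\mathbb E\le_P^s\mathbb F$ iff $\mathbb F\subseteq\mathbb E$.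
   Context: $\mathcal V$ is a countably infinite set of quantum variables, each with state space $\mathbb C^2$; for finite $V$, $\mathcal H_V=\bigotimes_{q\in V}\mathcal H_q$. $\mathcal D(\mathcal H)$: partial density operators (positive, trace $\le1$); $\mathcal P(\mathcal H)$: effects (positive operators with eigenvalues in $[0,1]$); $\sqsubseteq$: Löwner order. $\mathit{DProg}(V)$: completely positive trace-nonincreasing (CPTN) super-operators on $\mathcal L(\mathcal H_V)$, ordered by $\mathcal E\sqsubseteq\mathcal F$ iff $\mathcal F-\mathcal E$ is completely positive. $\mathit{NProg}(V)$ is the set of nonempty, convex, closed subsets of $\mathit{DProg}(V)$. Operators/super-operators on subsystems are implicitly extended by tensoring with identities. For $\mathbb E\in\mathit{NProg}(V)$ and a state $\rho$, $\mathbb E(\rho)=\{\mathcal E(\rho):\mathcal E\in\mathbb E\}$. Orders on subsets of $\mathit{DProg}(V)$: $\mathbb E\le_S\mathbb F$ iff $\forall\mathcal F\in\mathbb F\,\exists\mathcal E\in\mathbb E:\mathcal E\sqsubseteq\mathcal F$ (Smyth); $\mathbb E\le_H\mathbb F$ iff $\forall\mathcal E\in\mathbb E\,\exists\mathcal F\in\mathbb F:\mathcal E\sqsubseteq\mathcal F$ (Hoare); $\le_{EM}$ is the conjunction of $\le_H$ and $\le_S$ (Egli–Milner). ${\uparrow}\mathbb E=\{\mathcal F\in\mathit{DProg}(V):\exists\mathcal E\in\mathbb E,\ \mathcal E\sqsubseteq\mathcal F\}$ and ${\downarrow}\mathbb E=\{\mathcal F\in\mathit{DProg}(V):\exists\mathcal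 E\in\mathbb E,\ \mathcal F\sqsubseteq\mathcal E\}$. For $\Theta\subseteq\mathcal P(\mathcal H_W)$ and a state $\rho$, $\mathrm{Exp}_{dem}(\rho\models\Theta)=\inf_{M\in\Theta}{\rm tr}(M\rho)$, with the infimum over $\emptyset$ equal to ${\rm tr}(\rho)$. For finite $W$ and $\Theta,\Psi\subseteq\mathcal P(\mathcal H_W)$: $\mathbb E\models_{tot}(\Theta,\Psi)$ iff for every finite $X\supseteq V\cup W$ and $\rho\in\mathcal D(\mathcal H_X)$, $\mathrm{Exp}_{dem}(\rho\models\Theta)\le\inf\{\mathrm{Exp}_{dem}(\sigma\models\Psi):\sigma\in\mathbb E(\rho)\}$; $\mathbb E\models_{par}(\Theta,\Psi)$ iff for all such $X,\rho$, $\mathrm{Exp}_{dem}(\rho\models\Theta)\le\inf\{\mathrm{Exp}_{dem}(\sigma\models\Psi)+{\rm tr}(\rho)-{\rm tr}(\sigma):\sigma\in\mathbb E(\rho)\}$. $\mathbb E\le_T^s\mathbb F$ iff for every finite $W$ and all $\Theta,\Psi\subseteq\mathcal P(\mathcal H_W)$, $\mathbb E\models_{tot}(\Theta,\Psi)$ implies $\mathbb F\models_{tot}(\Theta,\Psi)$; $\le_P^s$ likewise with $\models_{par}$; $\equiv_T^s,\equiv_P^s$ are the corresponding kernels (refinement in both directions). *)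

theory Defs
  imports "HOL-Analysis.Analysis"
begin

text \<open>Quantum variables are natural numbers (a countably infinite set), each a qubit.
  For a finite set X of variables, the computational basis of H_X is indexed by the
  assignments X -> {False,True}, represented canonically as functions nat => bool that
  are False outside X.  Operators on H_X are represented by their matrix entries
  w.r.t. this basis (zero outside the basis of H_X); super-operators on L(H_V) by their
  coefficients: E(|s><t|) = sum over (u,v) of S((s,t),(u,v)) |u><v|.\<close>

type_synonym asg = "nat \<Rightarrow> bool"
type_synonym qop = "asg \<times> asg \<Rightarrow> complex"
type_synonym sop = "(asg \<times> asg) \<times> (asg \<times> asg) \<Rightarrow> complex"

definition asgs :: "nat set \<Rightarrow> asg set" where
  "asgs X = {\<sigma>. \<forall>q. q \<notin> X \<longrightarrow> \<not> \<sigma> q}"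

definition restr :: "nat set \<Rightarrow> asg \<Rightarrow> asg" where
  "restr A \<sigma> = (\<lambda>q. q \<in> A \<and> \<sigma> q)"

definition merge :: "nat set \<Rightarrow> asg \<Rightarrow> asg \<Rightarrow> asg" where
  "merge A s a = (\<lambda>q. if q \<in> A then s q else a q)"

definition wf_op :: "nat set \<Rightarrow> qop \<Rightarrow> bool" where
  "wf_op X M \<longleftrightarrow> (\<forall>u v. (u \<notin> asgs X \<or> v \<notin> asgs X) \<longrightarrow> M (u, v) = 0)"

definition wf_sop :: "nat set \<Rightarrow> sop \<Rightarrow> bool" where
  "wf_sop V S \<longleftrightarrow> (\<forall>s t u v. (s \<notin> asgs V \<or> t \<notin> asgs V \<or> u \<notin> asgs V \<or> v \<notin> asgs V)
                        \<longrightarrow> S ((s, t), (u, v)) = 0)"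

definition cnonneg :: "complex \<Rightarrow> bool" where
  "cnonneg z \<longleftrightarrow> Im z = 0 \<and> 0 \<le> Re z"

definition psd :: "nat set \<Rightarrow> qop \<Rightarrow> bool" where
  "psd X M \<longleftrightarrow> wf_op X M \<and>
     (\<forall>\<psi> :: asg \<Rightarrow> complex. cnonneg (\<Sum>u\<in>asgs X. \<Sum>v\<in>asgs X. cnj (\<psi> u) * M (u, v) * \<psi> v))"

definition qtr :: "nat set \<Rightarrow> qop \<Rightarrow> complex" where
  "qtr X M = (\<Sum>u\<in>asgs X. M (u, u))"

definition qmult :: "nat set \<Rightarrow> qop \<Rightarrow> qop \<Rightarrow> qop" where
  "qmult X A B = (\<lambda>(u, v). \<Sum>w\<in>asgs X. A (u, w) * B (w, v))"

definition qid :: "nat set \<Rightarrow> qop" where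
  "qid X = (\<lambda>(u, v). if u \<in> asgs X \<and> u = v then 1 else 0)"

definition dens :: "nat set \<Rightarrow> qop set" where
  "dens X = {\<rho>. psd X \<rho> \<and> Re (qtr X \<rho>) \<le> 1}"

definition effects :: "nat set \<Rightarrow> qop set" where
  "effects X = {M. psd X M \<and> psd X (\<lambda>p. qid X p - M p)}"

text \<open>cylindric extension of an operator M on H_W to H_X (W subset of X): M tensor identity\<close>
definition ext_op :: "nat set \<Rightarrow> nat set \<Rightarrow> qop \<Rightarrow> qop" where
  "ext_op W X M = (\<lambda>(u, v). if u \<in> asgs X \<and> v \<in> asgs X \<and> restr (X - W) u = restr (X - W) v
                           then M (restr W u, restr W v) else 0)"

text \<open>application of a super-operator S on L(H_V), extended by identity, to an operator on H_X\<close>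
definition sapp :: "nat set \<Rightarrow> nat set \<Rightarrow> sop \<Rightarrow> qop \<Rightarrow> qop" where
  "sapp V X S \<rho> = (\<lambda>(u, v). if u \<in> asgs X \<and> v \<in> asgs X then
      (\<Sum>s\<in>asgs V. \<Sum>t\<in>asgs V. S ((s, t), (restr V u, restr V v)) *
          \<rho> (merge V s (restr (X - V) u), merge V t (restr (X - V) v)))
     else 0)"

definition CP :: "nat set \<Rightarrow> sop \<Rightarrow> bool" where
  "CP V S \<longleftrightarrow> (\<forall>X. finite X \<and> V \<subseteq> X \<longrightarrow> (\<forall>\<rho>. psd X \<rho> \<longrightarrow> psd X (sapp V X S \<rho>)))"

definition trace_nonincr :: "nat set \<Rightarrow> sop \<Rightarrow> bool" where
  "trace_nonincr V S \<longleftrightarrow> (\<forall>\<rho>\<in>dens V. Re (qtr V (sapp V V S \<rho>)) \<le> Re (qtr V \<rho>))"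

definition trace_pres :: "nat set \<Rightarrow> sop \<Rightarrow> bool" where
  "trace_pres V S \<longleftrightarrow> (\<forall>\<rho>\<in>dens V. qtr V (sapp V V S \<rho>) = qtr V \<rho>)"

definition DProg :: "nat set \<Rightarrow> sop set" where
  "DProg V = {S. wf_sop V S \<and> CP V S \<and> trace_nonincr V S}"

definition sle :: "nat set \<Rightarrow> sop \<Rightarrow> sop \<Rightarrow> bool" where
  "sle V E F \<longleftrightarrow> CP V (\<lambda>x. F x - E x)"

definition convex_sops :: "sop set \<Rightarrow> bool" where
  "convex_sops A \<longleftrightarrow> (\<forall>E\<in>A. \<forall>F\<in>A. \<forall>l::real. 0 \<le> l \<and> l \<le> 1 \<longrightarrow>
       (\<lambda>x. of_real l * E x + of_real (1 - l) * F x) \<in> A)"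

text \<open>closedness w.r.t. the (product = entrywise) topology on coefficient functions\<close>
definition NProg :: "nat set \<Rightarrow> sop set set" where
  "NProg V = {A. A \<noteq> {} \<and> A \<subseteq> DProg V \<and> convex_sops A \<and> closed A}"

definition image_state :: "nat set \<Rightarrow> nat set \<Rightarrow> sop set \<Rightarrow> qop \<Rightarrow> qop set" where
  "image_state V X A \<rho> = {sapp V X S \<rho> | S. S \<in> A}"

definition smyth :: "nat set \<Rightarrow> sop set \<Rightarrow> sop set \<Rightarrow> bool" where
  "smyth V A B \<longleftrightarrow> (\<forall>F\<in>B. \<exists>E\<in>A. sle V E F)"

definition hoare :: "nat set \<Rightarrow> sop set \<Rightarrow> sop set \<Rightarrow> bool" where
  "hoare V A B \<longleftrightarrow> (\<forall>E\<in>A. \<exists>F\<in>B. sle V E F)"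

definition egli_milner :: "nat set \<Rightarrow> sop set \<Rightarrow> sop set \<Rightarrow> bool" where
  "egli_milner V A B \<longleftrightarrow> hoare V A B \<and> smyth V A B"

definition upc :: "nat set \<Rightarrow> sop set \<Rightarrow> sop set" where
  "upc V A = {F\<in>DProg V. \<exists>E\<in>A. sle V E F}"

definition downc :: "nat set \<Rightarrow> sop set \<Rightarrow> sop set" where
  "downc V A = {F\<in>DProg V. \<exists>E\<in>A. sle V F E}"

definition exp_dem :: "nat set \<Rightarrow> nat set \<Rightarrow> qop \<Rightarrow> qop set \<Rightarrow> real" where
  "exp_dem W X \<rho> \<Theta> = (if \<Theta> = {} then Re (qtr X \<rho>)
      else Inf ((\<lambda>M. Re (qtr X (qmult X (ext_op W X M) \<rho>))) ` \<Theta>))"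

definition models_tot :: "nat set \<Rightarrow> sop set \<Rightarrow> nat set \<Rightarrow> qop set \<Rightarrow> qop set \<Rightarrow> bool" where
  "models_tot V A W \<Theta> \<Psi> \<longleftrightarrow> (\<forall>X. finite X \<and> V \<union> W \<subseteq> X \<longrightarrow> (\<forall>\<rho>\<in>dens X.
      exp_dem W X \<rho> \<Theta> \<le> Inf ((\<lambda>\<sigma>. exp_dem W X \<sigma> \<Psi>) ` image_state V X A \<rho>)))"

definition models_par :: "nat set \<Rightarrow> sop set \<Rightarrow> nat set \<Rightarrow> qop set \<Rightarrow> qop set \<Rightarrow> bool" where
  "models_par V A W \<Theta> \<Psi> \<longleftrightarrow> (\<forall>X. finite X \<and> V \<union> W \<subseteq> X \<longrightarrow> (\<forall>\<rho>\<in>dens X.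
      exp_dem W X \<rho> \<Theta> \<le> Inf ((\<lambda>\<sigma>. exp_dem W X \<sigma> \<Psi> + Re (qtr X \<rho>) - Re (qtr X \<sigma>))
                                   ` image_state V X A \<rho>)))"

definition refine_T :: "nat set \<Rightarrow> sop set \<Rightarrow> sop set \<Rightarrow> bool" where
  "refine_T V A B \<longleftrightarrow> (\<forall>W. finite W \<longrightarrow> (\<forall>\<Theta> \<Psi>. \<Theta> \<subseteq> effects W \<and> \<Psi> \<subseteq> effects W \<longrightarrow>
      models_tot V A W \<Theta> \<Psi> \<longrightarrow> models_tot V B W \<Theta> \<Psi>))"

definition refine_P :: "nat set \<Rightarrow> sop set \<Rightarrow> sop set \<Rightarrow> bool" where
  "refine_P V A B \<longleftrightarrow> (\<forall>W. finite W \<longrightarrow> (\<forall>\<Theta> \<Psi>. \<Theta> \<subseteq> effects W \<and> \<Psi> \<subseteq> effects W \<longrightarrow>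
      models_par V A W \<Theta> \<Psi> \<longrightarrow> models_par V B W \<Theta> \<Psi>))"

definition equiv_T :: "nat set \<Rightarrow> sop set \<Rightarrow> sop set \<Rightarrow> bool" where
  "equiv_T V A B \<longleftrightarrow> refine_T V A B \<and> refine_T V B A"

definition equiv_P :: "nat set \<Rightarrow> sop set \<Rightarrow> sop set \<Rightarrow> bool" where
  "equiv_P V A B \<longleftrightarrow> refine_P V A B \<and> refine_P V B A"

end

theory Submission
  imports Defs
begin

text \<open>
  Soundness is monotonicity of \<open>tr(M \<sigma>)\<close> and antitonicity of \<open>tr(M \<sigma>) - tr(\<sigma>)\<close> in \<open>\<sigma>\<close> for an effect \<open>M\<close>.
  For completeness, suppose \<open>T\<close> dominates no member of the compact convex set \<open>A\<close>. Projecting the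
  origin onto the closed convex set of all \<open>S - T + C\<close> with \<open>S \<in> A\<close> and \<open>C\<close> completely positive
  yields a Choi matrix \<open>H \<ge> 0\<close>, rescaled to an effect, and \<open>\<epsilon> > 0\<close> with
  \<open>tr(H S(\<Omega>)) \<ge> tr(H T(\<Omega>)) + \<epsilon>\<close> for all \<open>S \<in> A\<close>, where \<open>\<Omega>\<close> is the maximally entangled state of
  \<open>V\<close> and a disjoint copy of \<open>V\<close>. The specification with postcondition \<open>{H}\<close> and precondition
  \<open>{S\<^sup>\<dagger>(H) | S \<in> A}\<close> is then met by \<open>A\<close> and refuted by \<open>T\<close> at \<open>\<Omega>\<close>. Partial correctness is the mirror
  image, with \<open>I - H\<close> and \<open>I - S\<^sup>\<dagger>(H)\<close>. A completely positive difference of two trace-preserving maps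
  has a positive Choi matrix of trace zero, hence vanishes, which gives the last part.
\<close>

subsection \<open>Positive forms on finite index sets\<close>

text \<open>Arbitrary index sets, rather than assignment sets only, allow inductions that delete one
  basis index at a time.\<close>

definition qform :: "'a set \<Rightarrow> ('a \<times> 'a \<Rightarrow> complex) \<Rightarrow> ('a \<Rightarrow> complex) \<Rightarrow> complex" where
  "qform I M \<psi> = (\<Sum>u\<in>I. \<Sum>v\<in>I. cnj (\<psi> u) * M (u, v) * \<psi> v)"

definition pos_form :: "'a set \<Rightarrow> ('a \<times> 'a \<Rightarrow> complex) \<Rightarrow> bool" where
  "pos_form I M \<longleftrightarrow> (\<forall>\<psi>. cnonneg (qform I M \<psi>))"

lemma psd_iff: "psd X M \<longleftrightarrow> wf_op X M \<and> pos_form (asgs X) M"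
  by (simp add: psd_def pos_form_def qform_def)

lemma cnonneg_0 [simp]: "cnonneg 0"
  by (simp add: cnonneg_def)

lemma cnonneg_add: "cnonneg a \<Longrightarrow> cnonneg b \<Longrightarrow> cnonneg (a + b)"
  by (simp add: cnonneg_def)

lemma cnonneg_sum: "(\<And>i. i \<in> A \<Longrightarrow> cnonneg (f i)) \<Longrightarrow> cnonneg (sum f A)"
  by (induction A rule: infinite_finite_induct) (auto intro: cnonneg_add)

lemma cnonneg_scale: "0 \<le> r \<Longrightarrow> cnonneg a \<Longrightarrow> cnonneg (of_real r * a)"
  by (simp add: cnonneg_def)

lemma qform_subset:
  assumes "finite I" "J \<subseteq> I" "\<And>u. u \<in> I - J \<Longrightarrow> \<psi> u = 0"
  shows "qform I M \<psi> = qform J M \<psi>"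
proof -
  have "(\<Sum>v\<in>I. cnj (\<psi> u) * M (u, v) * \<psi> v) = (\<Sum>v\<in>J. cnj (\<psi> u) * M (u, v) * \<psi> v)" for u
    using assms by (intro sum.mono_neutral_right) auto
  moreover have "(\<Sum>u\<in>I. \<Sum>v\<in>J. cnj (\<psi> u) * M (u, v) * \<psi> v)
    = (\<Sum>u\<in>J. \<Sum>v\<in>J. cnj (\<psi> u) * M (u, v) * \<psi> v)"
    using assms by (intro sum.mono_neutral_right) auto
  ultimately show ?thesis by (simp add: qform_def)
qed

lemma pos_form_subset:
  assumes "finite I" "J \<subseteq> I" "pos_form I M"
  shows "pos_form J M"
  unfolding pos_form_def
proof
  fix \<psi> :: "'a \<Rightarrow> complex"
  let ?\<phi> = "\<lambda>u. if u \<in> J then \<psi> u else 0"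
  have "qform J M \<psi> = qform J M ?\<phi>"
    by (simp add: qform_def cong: sum.cong)
  also have "\<dots> = qform I M ?\<phi>"
    using assms by (intro qform_subset [symmetric]) auto
  finally show "cnonneg (qform J M \<psi>)"
    using assms(3) by (simp add: pos_form_def)
qed

lemma pos_form_diag:
  assumes "finite I" "pos_form I M" "i \<in> I"
  shows "cnonneg (M (i, i))"
proof -
  have "pos_form {i} M"
    using assms pos_form_subset by blast
  then have "cnonneg (qform {i} M (\<lambda>_. 1))"
    by (simp add: pos_form_def)
  then show ?thesis by (simp add: qform_def)
qed

text \<open>Testing on the vector with entry 1 at \<open>u\<close> and \<open>c\<close> at
  \<open>v\<close>. Suitable phases and sizes of \<open>c\<close> give the entrywise facts that
  follow.\<close>

lemma pos_form_pair:
  assumes "finite I" "pos_form I M" "u \<in> I" "v \<in> I" "u \<noteq> v"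
  shows "cnonneg (M (u, u) + c * M (u, v) + cnj c * M (v, u) + of_real ((cmod c)\<^sup>2) * M (v, v))"
proof -
  have "pos_form {u, v} M"
    using assms pos_form_subset [of I "{u, v}" M] by simp
  then have "cnonneg (qform {u, v} M (\<lambda>w. if w = u then 1 else c))"
    by (simp only: pos_form_def)
  moreover have "qform {u, v} M (\<lambda>w. if w = u then 1 else c)
    = M (u, u) + c * M (u, v) + cnj c * M (v, u) + of_real ((cmod c)\<^sup>2) * M (v, v)"
    using assms(5) complex_norm_square [of c] by (simp add: qform_def algebra_simps)
  ultimately show ?thesis by simp
qed

text \<open>Over the complex numbers positivity forces this: \<open>c = 1\<close> makes the
  imaginary parts of the two entries cancel, and \<open>c = \<i>\<close> makes their real parts
  agree.\<close>

lemma pos_form_hermitian: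
  assumes "finite I" "pos_form I M" "u \<in> I" "v \<in> I"
  shows "M (v, u) = cnj (M (u, v))"
proof (cases "u = v")
  case True
  then show ?thesis
    using pos_form_diag [OF assms(1-3)] by (simp add: cnonneg_def complex_eq_iff)
next
  case False
  have "Im (M (u, u)) = 0" "Im (M (v, v)) = 0"
    using pos_form_diag [OF assms(1,2)] assms(3,4) by (auto simp: cnonneg_def)
  then show ?thesis
    using pos_form_pair [OF assms False, of 1] pos_form_pair [OF assms False, of \<i>]
    by (simp add: cnonneg_def complex_eq_iff)
qed

text \<open>The phases 1, -1, \<open>\<i>\<close> and \<open>-\<i>\<close> bound the real and
  imaginary parts separately, each by half the sum of the two diagonal entries. A bound this crude
  suffices for compactness.\<close>

lemma pos_form_entry_bound:
  assumes "finite I" "pos_form I M" "u \<in> I" "v \<in> I"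
  shows "cmod (M (u, v)) \<le> Re (M (u, u)) + Re (M (v, v))"
proof (cases "u = v")
  case True
  then show ?thesis
    using pos_form_diag [OF assms(1-3)] cmod_eq_Re [of "M (u, u)"] by (simp add: cnonneg_def)
next
  case False
  have h: "M (v, u) = cnj (M (u, v))"
    using pos_form_hermitian [OF assms] .
  have "\<bar>Re (M (u, v))\<bar> \<le> (Re (M (u, u)) + Re (M (v, v))) / 2"
    using pos_form_pair [OF assms False, of 1] pos_form_pair [OF assms False, of "-1"] h
    by (auto simp: cnonneg_def abs_if)
  moreover have "\<bar>Im (M (u, v))\<bar> \<le> (Re (M (u, u)) + Re (M (v, v))) / 2"
    using pos_form_pair [OF assms False, of \<i>] pos_form_pair [OF assms False, of "-\<i>"] h
    by (auto simp: cnonneg_def abs_if)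
  ultimately show ?thesis
    using cmod_le [of "M (u, v)"] by simp
qed

text \<open>With \<open>M (v, v) = 0\<close> the two-index form is affine in \<open>c\<close>, so it
  stays nonnegative only if its slope vanishes.\<close>

lemma pos_form_zero_row:
  assumes "finite I" "pos_form I M" "u \<in> I" "v \<in> I" "M (v, v) = 0"
  shows "M (u, v) = 0"
proof (cases "u = v")
  case True
  then show ?thesis using assms(5) by simp
next
  case False
  have h: "M (v, u) = cnj (M (u, v))"
    using pos_form_hermitian [OF assms(1-4)] .
  show ?thesis
  proof (rule ccontr)
    assume "M (u, v) \<noteq> 0"
    then have m: "(cmod (M (u, v)))\<^sup>2 > 0" by simp
    \<comment> \<open>This \<open>k\<close> turns the expression below into
      \<open>- Re (M (u, u)) - 2\<close>, which is negative.\<close>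
    define k where "k = (Re (M (u, u)) + 1) / (cmod (M (u, v)))\<^sup>2"
    have "Re (M (u, u)) - 2 * k * (cmod (M (u, v)))\<^sup>2 \<ge> 0"
      using pos_form_pair [OF assms(1-4) False, of "- of_real k * cnj (M (u, v))"] h assms(5)
      unfolding cmod_power2 by (simp add: cnonneg_def power2_eq_square algebra_simps)
    moreover have "k * (cmod (M (u, v)))\<^sup>2 = Re (M (u, u)) + 1"
      using m by (simp add: k_def)
    moreover have "Re (M (u, u)) \<ge> 0"
      using pos_form_diag [OF assms(1-3)] by (simp add: cnonneg_def)
    ultimately show False by (simp add: mult.assoc)
  qed
qed

lemma qform_insert:
  assumes "finite I" "i \<notin> I"
  shows "qform (insert i I) M \<psi> = cnj (\<psi> i) * M (i, i) * \<psi> i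
    + cnj (\<psi> i) * (\<Sum>v\<in>I. M (i, v) * \<psi> v) + (\<Sum>u\<in>I. cnj (\<psi> u) * M (u, i)) * \<psi> i + qform I M \<psi>"
  using assms by (simp add: qform_def sum.distrib sum_distrib_left sum_distrib_right mult.assoc)

text \<open>Completing the square: minimising the form over coordinate \<open>i\<close> leaves the
  form of the Schur complement.\<close>

lemma pos_form_schur_complement:
  assumes "finite I" "i \<notin> I" "pos_form (insert i I) M" "M (i, i) \<noteq> 0"
  shows "pos_form I (\<lambda>(u, v). M (u, v) - M (u, i) * M (i, v) / M (i, i))"
  unfolding pos_form_def
proof
  fix \<psi> :: "'a \<Rightarrow> complex"
  define a where "a = M (i, i)"
  define r where "r = (\<Sum>v\<in>I. M (i, v) * \<psi> v)"
  \<comment> \<open>The minimising value at \<open>i\<close>: the pivot term and both cross terms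
    then add up to \<open>- cnj r * r / a\<close>.\<close>
  let ?\<phi> = "\<psi>(i := - r / a)"
  have a: "cnj a = a" "a \<noteq> 0"
    using pos_form_hermitian [of "insert i I" M i i] assms by (auto simp: a_def)
  have r': "(\<Sum>u\<in>I. cnj (\<psi> u) * M (u, i)) = cnj r"
    unfolding r_def cnj_sum
  proof (rule sum.cong)
    fix u assume "u \<in> I"
    then have "M (u, i) = cnj (M (i, u))"
      using pos_form_hermitian [of "insert i I" M i u] assms by blast
    then show "cnj (\<psi> u) * M (u, i) = cnj (M (i, u) * \<psi> u)" by simp
  qed simp
  have "qform (insert i I) M ?\<phi> = cnj (?\<phi> i) * a * ?\<phi> i + cnj (?\<phi> i) * (\<Sum>v\<in>I. M (i, v) * ?\<phi> v)
     + (\<Sum>u\<in>I. cnj (?\<phi> u) * M (u, i)) * ?\<phi> i + qform I M ?\<phi>"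
    unfolding a_def by (rule qform_insert [OF assms(1,2)])
  also have "(\<Sum>v\<in>I. M (i, v) * ?\<phi> v) = r"
    unfolding r_def using assms(2) by (intro sum.cong) auto
  also have "(\<Sum>u\<in>I. cnj (?\<phi> u) * M (u, i)) = cnj r"
    unfolding r' [symmetric] using assms(2) by (intro sum.cong) auto
  also have "qform I M ?\<phi> = qform I M \<psi>"
    unfolding qform_def using assms(2) by (intro sum.cong) auto
  finally have "qform (insert i I) M ?\<phi> = qform I M \<psi> - cnj r * r / a"
    using a by (simp add: field_simps fun_upd_def)
  also have "cnj r * r / a = (\<Sum>u\<in>I. \<Sum>v\<in>I. cnj (\<psi> u) * (M (u, i) * M (i, v) / a) * \<psi> v)"
    unfolding r' [symmetric] unfolding r_def sum_product sum_divide_distrib by (simp add: mult_ac)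
  also have "qform I M \<psi> - \<dots> = qform I (\<lambda>(u, v). M (u, v) - M (u, i) * M (i, v) / a) \<psi>"
    by (simp add: qform_def sum_subtractf [symmetric] algebra_simps)
  finally show "cnonneg (qform I (\<lambda>(u, v). M (u, v) - M (u, i) * M (i, v) / M (i, i)) \<psi>)"
    using assms(3) by (metis a_def pos_form_def)
qed

text \<open>Splitting off one index by a Schur complement writes \<open>A\<close> as a rank-one form plus a
  positive form on the remaining indices; this replaces the spectral theorem.\<close>

lemma pos_form_trace_product:
  assumes "finite I" "pos_form I A" "pos_form I B"
  shows "cnonneg (\<Sum>u\<in>I. \<Sum>v\<in>I. A (u, v) * B (v, u))"
  using assms
proof (induction I arbitrary: A rule: finite_induct)
  case empty
  then show ?case by simp
next
  case (insert i I)
  let ?J = "insert i I"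
  have J: "finite ?J" using insert by simp
  have posB: "pos_form I B"
    using pos_form_subset [OF J _ insert.prems(2)] by blast
  show ?case
  proof (cases "A (i, i) = 0")
    \<comment> \<open>A zero pivot forces its whole row and column to vanish, so index
      \<open>i\<close> contributes nothing.\<close>
    case True
    have z: "A (u, i) = 0" "A (i, u) = 0" if "u \<in> ?J" for u
      using pos_form_zero_row [OF J insert.prems(1) that _ True]
        pos_form_hermitian [OF J insert.prems(1) that, of i] by auto
    have "(\<Sum>u\<in>?J. \<Sum>v\<in>?J. A (u, v) * B (v, u)) = (\<Sum>u\<in>I. \<Sum>v\<in>I. A (u, v) * B (v, u))"
      using insert.hyps z by (simp cong: sum.cong)
    moreover have "pos_form I A"
      using pos_form_subset [OF J _ insert.prems(1)] by blast
    ultimately show ?thesis using insert.IH posB by simp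
  next
    case False
    define a where "a = A (i, i)"
    define A' where "A' = (\<lambda>(u, v). A (u, v) - A (u, i) * A (i, v) / a)"
    have "pos_form I A'"
      unfolding A'_def a_def by (rule pos_form_schur_complement [OF insert.hyps insert.prems(1) False])
    then have 1: "cnonneg (\<Sum>u\<in>I. \<Sum>v\<in>I. A' (u, v) * B (v, u))"
      using insert.IH posB by blast
    have ca: "cnonneg a"
      using pos_form_diag [OF J insert.prems(1)] by (simp add: a_def)
    then have a: "a = of_real (Re a)" "Re a \<ge> 0"
      by (auto simp: cnonneg_def complex_eq_iff)
    have z: "A' (u, i) = 0" "A' (i, u) = 0" for u
      using False by (auto simp: A'_def a_def)
    have "(\<Sum>u\<in>?J. \<Sum>v\<in>?J. A' (u, v) * B (v, u)) = (\<Sum>u\<in>I. \<Sum>v\<in>I. A' (u, v) * B (v, u))"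
      using insert.hyps z by simp
    \<comment> \<open>By hermiticity of \<open>A\<close>, the rank-one part paired with
      \<open>B\<close> is the form of \<open>B\<close> at column \<open>i\<close> of
      \<open>A\<close>.\<close>
    moreover have "(\<Sum>u\<in>?J. \<Sum>v\<in>?J. A (u, i) * A (i, v) * B (v, u))
        = qform ?J B (\<lambda>u. A (u, i))"
      unfolding qform_def
      apply (subst sum.swap)
      using pos_form_hermitian [OF J insert.prems(1), of _ i]
      by (intro sum.cong refl) (auto simp: mult_ac)
    moreover have "(\<Sum>u\<in>?J. \<Sum>v\<in>?J. A (u, v) * B (v, u))
      = (\<Sum>u\<in>?J. \<Sum>v\<in>?J. A' (u, v) * B (v, u))
        + of_real (1 / Re a) * (\<Sum>u\<in>?J. \<Sum>v\<in>?J. A (u, i) * A (i, v) * B (v, u))"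
    proof -
      have "A (u, v) * B (v, u) = A' (u, v) * B (v, u)
          + of_real (1 / Re a) * (A (u, i) * A (i, v) * B (v, u))" for u v
        by (subst a(1), simp add: A'_def algebra_simps) (subst a(1), simp)
      then show ?thesis
        by (simp only: sum.distrib sum_distrib_left)
    qed
    ultimately show ?thesis
      using 1 insert.prems(2) a(2)
      by (auto simp: pos_form_def intro!: cnonneg_add cnonneg_scale simp del: of_real_divide)
  qed
qed

subsection \<open>Partial traces and super-operators\<close>

lemma finite_asgs [simp]:
  assumes "finite X"
  shows "finite (asgs X)"
proof (rule finite_subset)
  show "asgs X \<subseteq> (\<lambda>A q. q \<in> A) ` Pow X"
  proof
    fix \<sigma> assume "\<sigma> \<in> asgs X"
    then have "{q. \<sigma> q} \<in> Pow X" by (auto simp: asgs_def)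
    then show "\<sigma> \<in> (\<lambda>A q. q \<in> A) ` Pow X"
      by (rule rev_image_eqI) simp
  qed
qed (use assms in simp)

section \<open>Splitting assignments along a subsystem, and partial traces\<close>

lemma restr_in_asgs [simp]: "restr A \<sigma> \<in> asgs A"
  by (simp add: asgs_def restr_def)

lemma restr_merge_same: "w \<in> asgs W \<Longrightarrow> restr W (merge W w a) = w"
  by (auto simp: restr_def merge_def asgs_def)

lemma restr_merge_compl: "a \<in> asgs (X - W) \<Longrightarrow> restr (X - W) (merge W w a) = a"
  by (auto simp: restr_def merge_def asgs_def)

lemma merge_restr_restr: "W \<subseteq> X \<Longrightarrow> u \<in> asgs X \<Longrightarrow> merge W (restr W u) (restr (X - W) u) = u"
  by (auto simp: restr_def merge_def asgs_def)

lemma merge_in_asgs_compl: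
  assumes "W \<subseteq> X" "w \<in> asgs W" "a \<in> asgs (X - W)"
  shows "merge W w a \<in> asgs X"
  using assms by (auto simp: asgs_def merge_def)

text \<open>The tensor factorisation of the state space, seen on basis labels: an assignment on
  \<open>X\<close> is a pair of assignments on \<open>W\<close> and on its complement.\<close>

lemma sum_asgs_split:
  assumes "W \<subseteq> X"
  shows "(\<Sum>u\<in>asgs X. f u) = (\<Sum>w\<in>asgs W. \<Sum>a\<in>asgs (X - W). f (merge W w a))"
proof -
  have "(\<Sum>u\<in>asgs X. f u) = (\<Sum>(w, a)\<in>asgs W \<times> asgs (X - W). f (merge W w a))"
    by (rule sum.reindex_bij_witness [where i = "\<lambda>(w, a). merge W w a"
          and j = "\<lambda>u. (restr W u, restr (X - W) u)"])
      (use assms in \<open>auto simp: restr_merge_same restr_merge_compl merge_restr_restr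
         merge_in_asgs_compl\<close>)
  then show ?thesis by (simp add: sum.cartesian_product)
qed

text \<open>The partial trace over \<open>X - W\<close>, adjoint to \<open>ext_op\<close>. The value
  0 elsewhere is what \<open>wf_op\<close> demands.\<close>

definition ptr :: "nat set \<Rightarrow> nat set \<Rightarrow> qop \<Rightarrow> qop" where
  "ptr W X \<rho> = (\<lambda>(u, v). if u \<in> asgs W \<and> v \<in> asgs W
     then \<Sum>a\<in>asgs (X - W). \<rho> (merge W u a, merge W v a) else 0)"

lemma qtr_qmult: "qtr X (qmult X A B) = (\<Sum>u\<in>asgs X. \<Sum>v\<in>asgs X. A (u, v) * B (v, u))"
  by (simp add: qtr_def qmult_def)

lemma qtr_ptr:
  assumes "W \<subseteq> X"
  shows "qtr W (ptr W X \<rho>) = qtr X \<rho>"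
  by (simp add: qtr_def ptr_def sum_asgs_split [OF assms])

text \<open>The identity factor in \<open>ext_op\<close> collapses the double sum over the
  environment to a partial trace. Expectations on any \<open>X\<close> thereby reduce to the fixed
  system \<open>W\<close>.\<close>

lemma qtr_ext_op:
  assumes "finite X" "W \<subseteq> X"
  shows "qtr X (qmult X (ext_op W X M) \<rho>) = qtr W (qmult W M (ptr W X \<rho>))"
proof -
  have fin: "finite (asgs (X - W))" using assms by simp
  have "qtr X (qmult X (ext_op W X M) \<rho>) =
    (\<Sum>w\<in>asgs W. \<Sum>a\<in>asgs (X - W). \<Sum>w'\<in>asgs W. \<Sum>a'\<in>asgs (X - W).
      if a' = a then M (w, w') * \<rho> (merge W w' a', merge W w a) else 0)"
    unfolding qtr_qmult sum_asgs_split [OF assms(2)]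
    by (intro sum.cong refl)
      (auto simp: ext_op_def restr_merge_same restr_merge_compl merge_in_asgs_compl [OF assms(2)])
  also have "\<dots> = (\<Sum>w\<in>asgs W. \<Sum>a\<in>asgs (X - W). \<Sum>w'\<in>asgs W.
      M (w, w') * \<rho> (merge W w' a, merge W w a))"
    using fin by (simp add: sum.delta)
  also have "\<dots> = (\<Sum>w\<in>asgs W. \<Sum>w'\<in>asgs W. \<Sum>a\<in>asgs (X - W).
      M (w, w') * \<rho> (merge W w' a, merge W w a))"
    by (intro sum.cong refl sum.swap)
  also have "\<dots> = qtr W (qmult W M (ptr W X \<rho>))"
    by (simp add: qtr_qmult ptr_def sum_distrib_left)
  finally show ?thesis .
qed

lemma psd_ptr:
  assumes "finite X" "W \<subseteq> X" "psd X \<rho>"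
  shows "psd W (ptr W X \<rho>)"
  unfolding psd_iff pos_form_def
proof (intro conjI allI)
  show "wf_op W (ptr W X \<rho>)" by (auto simp: wf_op_def ptr_def)
  fix \<psi> :: "asg \<Rightarrow> complex"
  \<comment> \<open>\<open>\<phi> a\<close> is \<open>\<psi>\<close> tensored with the basis vector
    \<open>a\<close> of the environment; the forms of \<open>\<rho>\<close> at these vectors add up
    to the form of the partial trace.\<close>
  define \<phi> where "\<phi> a x = (if restr (X - W) x = a then \<psi> (restr W x) else 0)" for a x
  have fin: "finite (asgs (X - W))" using assms by simp
  have "qform (asgs X) \<rho> (\<phi> a) =
      (\<Sum>w\<in>asgs W. \<Sum>w'\<in>asgs W. cnj (\<psi> w) * \<rho> (merge W w a, merge W w' a) * \<psi> w')"
    if a: "a \<in> asgs (X - W)" for a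
  proof -
    have "qform (asgs X) \<rho> (\<phi> a) =
      (\<Sum>w\<in>asgs W. \<Sum>b\<in>asgs (X - W). if b = a then
        (\<Sum>w'\<in>asgs W. \<Sum>b'\<in>asgs (X - W). if b' = a then
           cnj (\<psi> w) * \<rho> (merge W w b, merge W w' b') * \<psi> w' else 0) else 0)"
      unfolding qform_def sum_asgs_split [OF assms(2)]
      by (intro sum.cong refl) (auto simp: \<phi>_def restr_merge_same restr_merge_compl intro!: sum.cong)
    then show ?thesis using fin a by (simp add: sum.delta)
  qed
  then have "(\<Sum>a\<in>asgs (X - W). qform (asgs X) \<rho> (\<phi> a)) = (\<Sum>a\<in>asgs (X - W).
     \<Sum>w\<in>asgs W. \<Sum>w'\<in>asgs W. cnj (\<psi> w) * \<rho> (merge W w a, merge W w' a) * \<psi> w')"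
    by (rule sum.cong [OF refl])
  also have "\<dots> = (\<Sum>w\<in>asgs W. \<Sum>a\<in>asgs (X - W). \<Sum>w'\<in>asgs W.
      cnj (\<psi> w) * \<rho> (merge W w a, merge W w' a) * \<psi> w')"
    by (rule sum.swap)
  also have "\<dots> = (\<Sum>w\<in>asgs W. \<Sum>w'\<in>asgs W. \<Sum>a\<in>asgs (X - W).
      cnj (\<psi> w) * \<rho> (merge W w a, merge W w' a) * \<psi> w')"
    by (intro sum.cong refl sum.swap)
  also have "\<dots> = qform (asgs W) (ptr W X \<rho>) \<psi>"
    by (simp add: qform_def ptr_def sum_distrib_left sum_distrib_right)
  finally show "cnonneg (qform (asgs W) (ptr W X \<rho>) \<psi>)"
    using assms(3) by (metis (no_types, lifting) cnonneg_sum psd_iff pos_form_def)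
qed

lemma merge_merge:
  assumes "V \<subseteq> W" "W \<subseteq> X" "a \<in> asgs (X - W)" "s \<in> asgs V"
  shows "merge V s (restr (X - V) (merge W u a)) = merge W (merge V s (restr (W - V) u)) a"
  using assms by (fastforce simp: merge_def restr_def asgs_def fun_eq_iff)

lemma restr_merge_subset: "V \<subseteq> W \<Longrightarrow> restr V (merge W u a) = restr V u"
  by (auto simp: merge_def restr_def fun_eq_iff)

text \<open>\<open>S\<close> acts inside \<open>W\<close> while the trace runs over the rest of
  \<open>X\<close>, so the two operations commute.\<close>

lemma ptr_sapp:
  assumes "V \<subseteq> W" "W \<subseteq> X"
  shows "ptr W X (sapp V X S \<rho>) = sapp V W S (ptr W X \<rho>)"
proof (rule ext, clarify)
  fix u v
  show "ptr W X (sapp V X S \<rho>) (u, v) = sapp V W S (ptr W X \<rho>) (u, v)"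
  proof (cases "u \<in> asgs W \<and> v \<in> asgs W")
    case True
    have m: "merge V s (restr (W - V) x) \<in> asgs W" if "s \<in> asgs V" for s x
      using merge_in_asgs_compl [OF assms(1) that] by simp
    have "ptr W X (sapp V X S \<rho>) (u, v) = (\<Sum>a\<in>asgs (X - W). \<Sum>s\<in>asgs V. \<Sum>t\<in>asgs V.
       S ((s, t), (restr V u, restr V v)) *
        \<rho> (merge W (merge V s (restr (W - V) u)) a, merge W (merge V t (restr (W - V) v)) a))"
      using True
      by (auto simp: ptr_def sapp_def merge_in_asgs_compl [OF assms(2)] merge_merge [OF assms]
          restr_merge_subset [OF assms(1)] intro!: sum.cong)
    also have "\<dots> = (\<Sum>s\<in>asgs V. \<Sum>a\<in>asgs (X - W). \<Sum>t\<in>asgs V.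
       S ((s, t), (restr V u, restr V v)) *
        \<rho> (merge W (merge V s (restr (W - V) u)) a, merge W (merge V t (restr (W - V) v)) a))"
      by (rule sum.swap)
    also have "\<dots> = (\<Sum>s\<in>asgs V. \<Sum>t\<in>asgs V. \<Sum>a\<in>asgs (X - W).
       S ((s, t), (restr V u, restr V v)) *
        \<rho> (merge W (merge V s (restr (W - V) u)) a, merge W (merge V t (restr (W - V) v)) a))"
      by (intro sum.cong refl sum.swap)
    also have "\<dots> = sapp V W S (ptr W X \<rho>) (u, v)"
      using True m by (simp add: sapp_def ptr_def sum_distrib_left)
    finally show ?thesis .
  qed (auto simp: ptr_def sapp_def)
qed

section \<open>Positivity of traces, linearity, and the completely positive cone\<close>

lemma psd_trace_product:
  assumes "finite W" "psd W A" "psd W B"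
  shows "cnonneg (qtr W (qmult W A B))"
  using pos_form_trace_product [of "asgs W" A B] assms by (simp add: psd_iff qtr_qmult)

lemma qtr_cnonneg: "finite X \<Longrightarrow> psd X \<rho> \<Longrightarrow> cnonneg (qtr X \<rho>)"
  unfolding qtr_def psd_iff
  using pos_form_diag [OF finite_asgs] by (intro cnonneg_sum) blast

lemma psd_add: "psd X A \<Longrightarrow> psd X B \<Longrightarrow> psd X (\<lambda>p. A p + B p)"
  by (auto simp: psd_def wf_op_def sum.distrib algebra_simps intro: cnonneg_add)

lemma psd_scale:
  assumes "0 \<le> r" "psd X A"
  shows "psd X (\<lambda>p. of_real r * A p)"
proof -
  have "qform (asgs X) (\<lambda>p. of_real r * A p) \<psi> = of_real r * qform (asgs X) A \<psi>" for \<psi>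
    by (simp add: qform_def sum_distrib_left mult_ac)
  then show ?thesis
    using assms by (simp add: psd_iff pos_form_def wf_op_def cnonneg_scale)
qed

lemma psd_zero: "psd X (\<lambda>p. 0)"
  by (simp add: psd_def wf_op_def)

lemma qtr_qmult_qid:
  assumes "finite X"
  shows "qtr X (qmult X (qid X) \<rho>) = qtr X \<rho>"
  unfolding qtr_qmult using assms by (simp add: qid_def qtr_def if_distrib [of "\<lambda>z. z * _"] sum.delta cong: if_cong)

lemma qtr_qmult_diff_left:
  "qtr X (qmult X (\<lambda>p. A p - B p) C) = qtr X (qmult X A C) - qtr X (qmult X B C)"
  by (simp add: qtr_qmult sum_subtractf algebra_simps)

lemma qtr_qmult_diff_right:
  "qtr X (qmult X A (\<lambda>p. B p - C p)) = qtr X (qmult X A B) - qtr X (qmult X A C)"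
  by (simp add: qtr_qmult sum_subtractf algebra_simps)

lemma qtr_qmult_scale_left: "qtr X (qmult X (\<lambda>p. c * A p) B) = c * qtr X (qmult X A B)"
  by (simp add: qtr_qmult sum_distrib_left mult_ac)

lemma qtr_diff: "qtr X (\<lambda>p. A p - B p) = qtr X A - qtr X B"
  by (simp add: qtr_def sum_subtractf)

lemma qtr_scale: "qtr X (\<lambda>p. c * A p) = c * qtr X A"
  by (simp add: qtr_def sum_distrib_left)

lemma sapp_add_left: "sapp V X (\<lambda>x. S x + T x) \<rho> = (\<lambda>p. sapp V X S \<rho> p + sapp V X T \<rho> p)"
  by (auto simp: sapp_def fun_eq_iff sum.distrib algebra_simps)

lemma sapp_diff_left: "sapp V X (\<lambda>x. S x - T x) \<rho> = (\<lambda>p. sapp V X S \<rho> p - sapp V X T \<rho> p)"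
  by (auto simp: sapp_def fun_eq_iff sum_subtractf algebra_simps)

lemma sapp_scale_left: "sapp V X (\<lambda>x. c * S x) \<rho> = (\<lambda>p. c * sapp V X S \<rho> p)"
  by (auto simp: sapp_def fun_eq_iff sum_distrib_left mult_ac)

lemma sapp_scale_right: "sapp V X S (\<lambda>p. c * \<rho> p) = (\<lambda>p. c * sapp V X S \<rho> p)"
  by (auto simp: sapp_def fun_eq_iff sum_distrib_left mult_ac)

lemma CP_zero: "CP V (\<lambda>x. 0)"
proof -
  have "sapp V X (\<lambda>x. 0) \<rho> = (\<lambda>p. 0)" for X \<rho>
    by (auto simp: sapp_def fun_eq_iff)
  then show ?thesis by (simp add: CP_def psd_zero)
qed

lemma CP_add: "CP V S \<Longrightarrow> CP V T \<Longrightarrow> CP V (\<lambda>x. S x + T x)"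
  by (simp add: CP_def sapp_add_left psd_add)

lemma CP_scale: "0 \<le> r \<Longrightarrow> CP V S \<Longrightarrow> CP V (\<lambda>x. of_real r * S x)"
  by (simp add: CP_def sapp_scale_left psd_scale)

lemma sle_refl: "sle V S S"
  by (simp add: sle_def CP_zero)

lemma sle_trans: "sle V S T \<Longrightarrow> sle V T U \<Longrightarrow> sle V S U"
  using CP_add [of V "\<lambda>x. T x - S x" "\<lambda>x. U x - T x"] by (simp add: sle_def)

text \<open>Dividing by one plus the trace covers the zero operator without a case
  distinction.\<close>

lemma psd_normalize:
  assumes "finite X" "psd X \<rho>"
  obtains r where "r > 0" "(\<lambda>p. of_real r * \<rho> p) \<in> dens X"
proof -
  let ?r = "1 / (1 + Re (qtr X \<rho>))"
  have t: "Re (qtr X \<rho>) \<ge> 0"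
    using qtr_cnonneg [OF assms] by (simp add: cnonneg_def)
  then have "?r > 0" "Re (qtr X (\<lambda>p. of_real ?r * \<rho> p)) \<le> 1"
    by (auto simp: qtr_scale simp del: of_real_divide)
  then show ?thesis
    using that [of ?r] psd_scale [of ?r X \<rho>] assms(2) by (simp add: dens_def)
qed

text \<open>\<open>trace_nonincr\<close> speaks of states of \<open>V\<close> only. Rescaling
  extends it to all positive operators, and the partial trace extends it to larger systems.\<close>

lemma trace_nonincr_psd:
  assumes "finite X" "V \<subseteq> X" "trace_nonincr V S" "psd X \<rho>"
  shows "Re (qtr X (sapp V X S \<rho>)) \<le> Re (qtr X \<rho>)"
proof -
  let ?\<rho> = "ptr V X \<rho>"
  have V: "finite V" using assms finite_subset by blast
  obtain r where r: "r > 0" "(\<lambda>p. of_real r * ?\<rho> p) \<in> dens V"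
    using psd_normalize [OF V psd_ptr [OF assms(1,2,4)]] .
  then have "Re (qtr V (sapp V V S (\<lambda>p. of_real r * ?\<rho> p))) \<le> Re (qtr V (\<lambda>p. of_real r * ?\<rho> p))"
    using assms(3) by (simp add: trace_nonincr_def)
  then have "Re (qtr V (sapp V V S ?\<rho>)) \<le> Re (qtr V ?\<rho>)"
    using r(1) by (simp add: sapp_scale_right qtr_scale)
  moreover have "sapp V V S ?\<rho> = ptr V X (sapp V X S \<rho>)"
    using ptr_sapp [of V V X S \<rho>] assms(2) by simp
  ultimately show ?thesis
    using qtr_ptr [OF assms(2)] by simp
qed

lemma trace_pres_psd:
  assumes "finite X" "V \<subseteq> X" "trace_pres V S" "psd X \<rho>"
  shows "qtr X (sapp V X S \<rho>) = qtr X \<rho>"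
proof -
  let ?\<rho> = "ptr V X \<rho>"
  have V: "finite V" using assms finite_subset by blast
  obtain r where r: "r > 0" "(\<lambda>p. of_real r * ?\<rho> p) \<in> dens V"
    using psd_normalize [OF V psd_ptr [OF assms(1,2,4)]] .
  then have "qtr V (sapp V V S (\<lambda>p. of_real r * ?\<rho> p)) = qtr V (\<lambda>p. of_real r * ?\<rho> p)"
    using assms(3) by (simp add: trace_pres_def)
  then have "qtr V (sapp V V S ?\<rho>) = qtr V ?\<rho>"
    using r(1) by (simp add: sapp_scale_right qtr_scale)
  moreover have "sapp V V S ?\<rho> = ptr V X (sapp V X S \<rho>)"
    using ptr_sapp [of V V X S \<rho>] assms(2) by simp
  ultimately show ?thesis
    using qtr_ptr [OF assms(2)] by simp
qed

subsection \<open>Soundness of the Smyth and Hoare orders\<close>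

text \<open>Both \<open>M\<close> and its complement pair nonnegatively with the reduced operator
  \<open>ptr W X \<rho>\<close>.\<close>

lemma effect_bounds:
  assumes "finite X" "W \<subseteq> X" "M \<in> effects W" "psd X \<rho>"
  shows "0 \<le> Re (qtr X (qmult X (ext_op W X M) \<rho>))"
    and "Re (qtr X (qmult X (ext_op W X M) \<rho>)) \<le> Re (qtr X \<rho>)"
proof -
  have W: "finite W" using assms finite_subset by blast
  have \<rho>: "psd W (ptr W X \<rho>)" using psd_ptr assms by blast
  show "0 \<le> Re (qtr X (qmult X (ext_op W X M) \<rho>))"
    using psd_trace_product [OF W _ \<rho>, of M] assms
    by (simp add: qtr_ext_op effects_def cnonneg_def)
  have "cnonneg (qtr W (qmult W (\<lambda>p. qid W p - M p) (ptr W X \<rho>)))"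
    using psd_trace_product [OF W _ \<rho>] assms(3) by (simp add: effects_def)
  then show "Re (qtr X (qmult X (ext_op W X M) \<rho>)) \<le> Re (qtr X \<rho>)"
    using assms W by (simp add: qtr_ext_op qtr_qmult_diff_left qtr_qmult_qid qtr_ptr cnonneg_def)
qed

text \<open>Gives the lower bound under which an \<open>Inf\<close> over program outputs can be
  traded for a universal quantifier.\<close>

lemma exp_dem_nonneg:
  assumes "finite X" "W \<subseteq> X" "\<Theta> \<subseteq> effects W" "psd X \<rho>"
  shows "0 \<le> exp_dem W X \<rho> \<Theta>"
  using assms effect_bounds(1) [OF assms(1,2) _ assms(4)] qtr_cnonneg [OF assms(1,4)]
  by (auto simp: exp_dem_def cnonneg_def intro!: cINF_greatest)

lemma exp_dem_lower:
  assumes "finite X" "W \<subseteq> X" "\<Theta> \<subseteq> effects W" "psd X \<rho>" "M \<in> \<Theta>"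
  shows "exp_dem W X \<rho> \<Theta> \<le> Re (qtr X (qmult X (ext_op W X M) \<rho>))"
proof -
  have "bdd_below ((\<lambda>M. Re (qtr X (qmult X (ext_op W X M) \<rho>))) ` \<Theta>)"
    using effect_bounds(1) [OF assms(1,2) _ assms(4)] assms(3)
    by (intro bdd_belowI [where m = 0]) auto
  then show ?thesis
    using assms(5) by (auto simp: exp_dem_def intro: cINF_lower)
qed

text \<open>\<open>effect_bounds\<close> applies to the positive difference of
  \<open>\<sigma>\<close> and \<open>\<rho>\<close>: an effect sees at least 0 and at most the full
  trace of it. The two bounds give the two claims.\<close>

lemma exp_dem_mono:
  assumes "finite X" "W \<subseteq> X" "\<Theta> \<subseteq> effects W" "psd X \<rho>" "psd X (\<lambda>p. \<sigma> p - \<rho> p)"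
  shows "exp_dem W X \<rho> \<Theta> \<le> exp_dem W X \<sigma> \<Theta>"
    and "exp_dem W X \<sigma> \<Theta> - Re (qtr X \<sigma>) \<le> exp_dem W X \<rho> \<Theta> - Re (qtr X \<rho>)"
proof -
  have \<sigma>: "psd X \<sigma>"
    using psd_add [OF assms(4,5)] by simp
  have tr: "Re (qtr X \<rho>) \<le> Re (qtr X \<sigma>)"
    using qtr_cnonneg [OF assms(1,5)] by (simp add: qtr_diff cnonneg_def)
  have *: "Re (qtr X (qmult X (ext_op W X M) \<rho>)) \<le> Re (qtr X (qmult X (ext_op W X M) \<sigma>))"
    "Re (qtr X (qmult X (ext_op W X M) \<sigma>)) - Re (qtr X \<sigma>)
       \<le> Re (qtr X (qmult X (ext_op W X M) \<rho>)) - Re (qtr X \<rho>)" if "M \<in> \<Theta>" for M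
    using effect_bounds [OF assms(1,2) _ assms(5), of M] that assms(3)
    by (auto simp: qtr_qmult_diff_right qtr_diff)
  show "exp_dem W X \<rho> \<Theta> \<le> exp_dem W X \<sigma> \<Theta>"
  proof (cases "\<Theta> = {}")
    case False
    have "exp_dem W X \<rho> \<Theta> \<le> Re (qtr X (qmult X (ext_op W X M) \<sigma>))" if "M \<in> \<Theta>" for M
      using exp_dem_lower [OF assms(1-4) that] *(1) [OF that] by simp
    then show ?thesis
      using False unfolding exp_dem_def [of W X \<sigma>] by (auto intro: cINF_greatest)
  qed (use tr in \<open>simp add: exp_dem_def\<close>)
  show "exp_dem W X \<sigma> \<Theta> - Re (qtr X \<sigma>) \<le> exp_dem W X \<rho> \<Theta> - Re (qtr X \<rho>)"
  proof (cases "\<Theta> = {}")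
    case False
    have "exp_dem W X \<sigma> \<Theta> - Re (qtr X \<sigma>) + Re (qtr X \<rho>)
        \<le> Re (qtr X (qmult X (ext_op W X M) \<rho>))" if "M \<in> \<Theta>" for M
      using exp_dem_lower [OF assms(1-3) \<sigma> that] *(2) [OF that] by simp
    then have "exp_dem W X \<sigma> \<Theta> - Re (qtr X \<sigma>) + Re (qtr X \<rho>) \<le> exp_dem W X \<rho> \<Theta>"
      using False unfolding exp_dem_def [of W X \<rho>] by (auto intro: cINF_greatest)
    then show ?thesis by simp
  qed (simp add: exp_dem_def)
qed

lemma DProg_psd:
  assumes "S \<in> DProg V" "finite X" "V \<subseteq> X" "psd X \<rho>"
  shows "psd X (sapp V X S \<rho>)" "Re (qtr X (sapp V X S \<rho>)) \<le> Re (qtr X \<rho>)"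
  using assms trace_nonincr_psd by (auto simp: DProg_def CP_def)

text \<open>Nonemptiness of \<open>A\<close> and boundedness below make \<open>Inf\<close> a genuine
  infimum, so bounding it means bounding every output.\<close>

lemma models_tot_iff:
  assumes "A \<noteq> {}" "A \<subseteq> DProg V" "\<Psi> \<subseteq> effects W"
  shows "models_tot V A W \<Theta> \<Psi> \<longleftrightarrow> (\<forall>X. finite X \<and> V \<union> W \<subseteq> X \<longrightarrow> (\<forall>\<rho>\<in>dens X. \<forall>S\<in>A.
           exp_dem W X \<rho> \<Theta> \<le> exp_dem W X (sapp V X S \<rho>) \<Psi>))"
proof -
  have "exp_dem W X \<rho> \<Theta> \<le> Inf ((\<lambda>\<sigma>. exp_dem W X \<sigma> \<Psi>) ` image_state V X A \<rho>) \<longleftrightarrow>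
      (\<forall>S\<in>A. exp_dem W X \<rho> \<Theta> \<le> exp_dem W X (sapp V X S \<rho>) \<Psi>)"
    if X: "finite X" "V \<union> W \<subseteq> X" and \<rho>: "\<rho> \<in> dens X" for X \<rho>
  proof -
    have "0 \<le> exp_dem W X (sapp V X S \<rho>) \<Psi>" if "S \<in> A" for S
      using exp_dem_nonneg [of X W \<Psi>] DProg_psd(1) [of S V X \<rho>] X \<rho> assms that
      by (auto simp: dens_def)
    then have "bdd_below ((\<lambda>\<sigma>. exp_dem W X \<sigma> \<Psi>) ` image_state V X A \<rho>)"
      by (intro bdd_belowI [where m = 0]) (auto simp: image_state_def)
    then show ?thesis
      using assms(1) by (subst le_cInf_iff) (auto simp: image_state_def)
  qed
  then show ?thesis by (simp add: models_tot_def cong: ball_cong)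
qed

text \<open>As for total correctness; the trace defect credited to each output is nonnegative
  because programs do not increase the trace.\<close>

lemma models_par_iff:
  assumes "A \<noteq> {}" "A \<subseteq> DProg V" "\<Psi> \<subseteq> effects W"
  shows "models_par V A W \<Theta> \<Psi> \<longleftrightarrow> (\<forall>X. finite X \<and> V \<union> W \<subseteq> X \<longrightarrow> (\<forall>\<rho>\<in>dens X. \<forall>S\<in>A.
           exp_dem W X \<rho> \<Theta> \<le> exp_dem W X (sapp V X S \<rho>) \<Psi> + Re (qtr X \<rho>) - Re (qtr X (sapp V X S \<rho>))))"
proof -
  have "exp_dem W X \<rho> \<Theta> \<le> Inf ((\<lambda>\<sigma>. exp_dem W X \<sigma> \<Psi> + Re (qtr X \<rho>) - Re (qtr X \<sigma>))
         ` image_state V X A \<rho>) \<longleftrightarrow>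
      (\<forall>S\<in>A. exp_dem W X \<rho> \<Theta> \<le> exp_dem W X (sapp V X S \<rho>) \<Psi> + Re (qtr X \<rho>) - Re (qtr X (sapp V X S \<rho>)))"
    if X: "finite X" "V \<union> W \<subseteq> X" and \<rho>: "\<rho> \<in> dens X" for X \<rho>
  proof -
    have "0 \<le> exp_dem W X (sapp V X S \<rho>) \<Psi> + Re (qtr X \<rho>) - Re (qtr X (sapp V X S \<rho>))"
      if "S \<in> A" for S
    proof -
      have *: "S \<in> DProg V" "V \<subseteq> X" "W \<subseteq> X" "psd X \<rho>"
        using that assms X \<rho> by (auto simp: dens_def)
      show ?thesis
        using exp_dem_nonneg [OF X(1) *(3) assms(3) DProg_psd(1) [OF *(1) X(1) *(2,4)]]
          DProg_psd(2) [OF *(1) X(1) *(2,4)] by simp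
    qed
    then have "bdd_below ((\<lambda>\<sigma>. exp_dem W X \<sigma> \<Psi> + Re (qtr X \<rho>) - Re (qtr X \<sigma>)) ` image_state V X A \<rho>)"
      by (intro bdd_belowI [where m = 0]) (auto simp: image_state_def)
    then show ?thesis
      using assms(1) by (subst le_cInf_iff) (auto simp: image_state_def)
  qed
  then show ?thesis by (simp add: models_par_def cong: ball_cong)
qed

lemma smyth_imp_refine_T:
  assumes "A \<in> NProg V" "B \<in> NProg V" "smyth V A B"
  shows "refine_T V A B"
  unfolding refine_T_def
proof (intro allI impI)
  fix W \<Theta> \<Psi>
  assume W: "finite W" and eff: "\<Theta> \<subseteq> effects W \<and> \<Psi> \<subseteq> effects W" and mod: "models_tot V A W \<Theta> \<Psi>"
  have A: "A \<noteq> {}" "A \<subseteq> DProg V" and B: "B \<noteq> {}" "B \<subseteq> DProg V"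
    using assms by (auto simp: NProg_def)
  have \<Psi>: "\<Psi> \<subseteq> effects W" using eff by simp
  show "models_tot V B W \<Theta> \<Psi>"
    unfolding models_tot_iff [OF B \<Psi>]
  proof (intro allI impI ballI)
    fix X \<rho> T
    assume X: "finite X \<and> V \<union> W \<subseteq> X" and \<rho>: "\<rho> \<in> dens X" and T: "T \<in> B"
    obtain S where S: "S \<in> A" "sle V S T"
      using assms(3) T by (auto simp: smyth_def)
    have "exp_dem W X \<rho> \<Theta> \<le> exp_dem W X (sapp V X S \<rho>) \<Psi>"
      using mod X \<rho> S(1) unfolding models_tot_iff [OF A \<Psi>] by blast
    also have "\<dots> \<le> exp_dem W X (sapp V X T \<rho>) \<Psi>"
    proof (rule exp_dem_mono(1))
      show "psd X (sapp V X S \<rho>)"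
        using DProg_psd(1) S(1) A X \<rho> by (auto simp: dens_def)
      show "psd X (\<lambda>p. sapp V X T \<rho> p - sapp V X S \<rho> p)"
        using S(2) X \<rho> by (auto simp: sle_def CP_def dens_def sapp_diff_left)
    qed (use X \<Psi> in auto)
    finally show "exp_dem W X \<rho> \<Theta> \<le> exp_dem W X (sapp V X T \<rho>) \<Psi>" .
  qed
qed

text \<open>The order is reversed: from \<open>S\<close> to a smaller \<open>T\<close> the
  expectation drops by at most the trace lost, and partial correctness credits lost trace in
  full.\<close>

lemma hoare_imp_refine_P:
  assumes "A \<in> NProg V" "B \<in> NProg V" "hoare V B A"
  shows "refine_P V A B"
  unfolding refine_P_def
proof (intro allI impI)
  fix W \<Theta> \<Psi>
  assume W: "finite W" and eff: "\<Theta> \<subseteq> effects W \<and> \<Psi> \<subseteq> effects W" and mod: "models_par V A W \<Theta> \<Psi>"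
  have A: "A \<noteq> {}" "A \<subseteq> DProg V" and B: "B \<noteq> {}" "B \<subseteq> DProg V"
    using assms by (auto simp: NProg_def)
  have \<Psi>: "\<Psi> \<subseteq> effects W" using eff by simp
  show "models_par V B W \<Theta> \<Psi>"
    unfolding models_par_iff [OF B \<Psi>]
  proof (intro allI impI ballI)
    fix X \<rho> T
    assume X: "finite X \<and> V \<union> W \<subseteq> X" and \<rho>: "\<rho> \<in> dens X" and T: "T \<in> B"
    obtain S where S: "S \<in> A" "sle V T S"
      using assms(3) T by (auto simp: hoare_def)
    have "exp_dem W X \<rho> \<Theta>
        \<le> exp_dem W X (sapp V X S \<rho>) \<Psi> + Re (qtr X \<rho>) - Re (qtr X (sapp V X S \<rho>))"
      using mod X \<rho> S(1) unfolding models_par_iff [OF A \<Psi>] by blast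
    moreover have "exp_dem W X (sapp V X S \<rho>) \<Psi> - Re (qtr X (sapp V X S \<rho>))
        \<le> exp_dem W X (sapp V X T \<rho>) \<Psi> - Re (qtr X (sapp V X T \<rho>))"
    proof (rule exp_dem_mono(2))
      show "psd X (sapp V X T \<rho>)"
        using DProg_psd(1) T B X \<rho> by (auto simp: dens_def)
      show "psd X (\<lambda>p. sapp V X S \<rho> p - sapp V X T \<rho> p)"
        using S(2) X \<rho> by (auto simp: sle_def CP_def dens_def sapp_diff_left)
    qed (use X \<Psi> in auto)
    ultimately show "exp_dem W X \<rho> \<Theta>
        \<le> exp_dem W X (sapp V X T \<rho>) \<Psi> + Re (qtr X \<rho>) - Re (qtr X (sapp V X T \<rho>))" by simp
  qed
qed

subsection \<open>The Heisenberg picture\<close>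

definition ketbra :: "asg \<Rightarrow> asg \<Rightarrow> qop" where
  "ketbra a b = (\<lambda>p. if p = (a, b) then 1 else 0)"

text \<open>Not normalised, so a projection only up to scale. Pairing an operator with it returns
  the quadratic form at \<open>\<psi>\<close>.\<close>

definition proj :: "nat set \<Rightarrow> (asg \<Rightarrow> complex) \<Rightarrow> qop" where
  "proj W \<psi> = (\<lambda>(u, v). if u \<in> asgs W \<and> v \<in> asgs W then \<psi> u * cnj (\<psi> v) else 0)"

text \<open>The adjoint of \<open>S\<close> with respect to the trace pairing, by its entries
  \<open>\<langle>t|S\<^sup>\<dagger>(M)|s\<rangle> = tr(M S(|s\<rangle>\<langle>t|))\<close>.\<close>

definition heis :: "nat set \<Rightarrow> nat set \<Rightarrow> sop \<Rightarrow> qop \<Rightarrow> qop" where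
  "heis V W S M = (\<lambda>(t, s). if t \<in> asgs W \<and> s \<in> asgs W
     then qtr W (qmult W M (sapp V W S (ketbra s t))) else 0)"

lemma psd_proj: "psd W (proj W \<psi>)"
  unfolding psd_iff pos_form_def
proof (intro conjI allI)
  show "wf_op W (proj W \<psi>)" by (simp add: wf_op_def proj_def)
  fix \<phi>
  let ?z = "\<Sum>u\<in>asgs W. cnj (\<phi> u) * \<psi> u"
  have "qform (asgs W) (proj W \<psi>) \<phi> = ?z * cnj ?z"
    unfolding cnj_sum sum_product by (simp add: qform_def proj_def mult_ac)
  also have "\<dots> = of_real ((cmod ?z)\<^sup>2)"
    by (rule complex_norm_square [symmetric])
  finally show "cnonneg (qform (asgs W) (proj W \<psi>) \<phi>)"
    by (simp add: cnonneg_def del: of_real_power)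
qed

lemma qtr_qmult_proj: "qtr W (qmult W M (proj W \<psi>)) = qform (asgs W) M \<psi>"
  unfolding qtr_qmult by (simp add: proj_def qform_def mult_ac)

text \<open>Linearity of \<open>sapp\<close>, applied to the expansion of \<open>\<rho>\<close> in
  matrix units.\<close>

lemma sapp_ketbra_expand:
  assumes "finite W" "V \<subseteq> W"
  shows "sapp V W S \<rho> (u, v) = (\<Sum>a\<in>asgs W. \<Sum>b\<in>asgs W. \<rho> (a, b) * sapp V W S (ketbra a b) (u, v))"
proof (cases "u \<in> asgs W \<and> v \<in> asgs W")
  case True
  have exp: "\<rho> (x, y) = (\<Sum>a\<in>asgs W. \<Sum>b\<in>asgs W. \<rho> (a, b) * ketbra a b (x, y))"
    if "x \<in> asgs W" "y \<in> asgs W" for x y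
  proof -
    have "(\<Sum>a\<in>asgs W. \<Sum>b\<in>asgs W. \<rho> (a, b) * ketbra a b (x, y))
       = (\<Sum>a\<in>asgs W. if x = a then (\<Sum>b\<in>asgs W. if y = b then \<rho> (a, b) else 0) else 0)"
      by (intro sum.cong) (auto simp: ketbra_def intro!: sum.cong)
    then show ?thesis using assms(1) that by (simp add: sum.delta')
  qed
  have m: "merge V s (restr (W - V) x) \<in> asgs W" if "s \<in> asgs V" for s x
    using merge_in_asgs_compl [OF assms(2) that] by simp
  let ?c = "\<lambda>s t. S ((s, t), (restr V u, restr V v))"
  let ?x = "\<lambda>s. merge V s (restr (W - V) u)" and ?y = "\<lambda>t. merge V t (restr (W - V) v)"
  have "sapp V W S \<rho> (u, v) = (\<Sum>s\<in>asgs V. \<Sum>t\<in>asgs V. ?c s t *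
      (\<Sum>a\<in>asgs W. \<Sum>b\<in>asgs W. \<rho> (a, b) * ketbra a b (?x s, ?y t)))"
    using True m by (auto simp: sapp_def exp [symmetric] intro!: sum.cong)
  also have "\<dots> = (\<Sum>(s, t)\<in>asgs V \<times> asgs V. \<Sum>(a, b)\<in>asgs W \<times> asgs W.
      \<rho> (a, b) * (?c s t * ketbra a b (?x s, ?y t)))"
    by (simp add: sum.cartesian_product [symmetric] sum_distrib_left mult_ac)
  also have "\<dots> = (\<Sum>(a, b)\<in>asgs W \<times> asgs W. \<Sum>(s, t)\<in>asgs V \<times> asgs V.
      \<rho> (a, b) * (?c s t * ketbra a b (?x s, ?y t)))"
    unfolding case_prod_unfold by (rule sum.swap)
  also have "\<dots> = (\<Sum>a\<in>asgs W. \<Sum>b\<in>asgs W. \<rho> (a, b) * sapp V W S (ketbra a b) (u, v))"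
    using True by (simp add: sum.cartesian_product [symmetric] sum_distrib_left sapp_def)
  finally show ?thesis .
qed (auto simp: sapp_def)

text \<open>True on matrix units by the choice of entries in \<open>heis\<close>, and in general by
  linearity.\<close>

lemma qtr_heis:
  assumes "finite W" "V \<subseteq> W"
  shows "qtr W (qmult W (heis V W S M) \<rho>) = qtr W (qmult W M (sapp V W S \<rho>))"
proof -
  let ?I = "asgs W"
  let ?f = "\<lambda>t s u v. M (u, v) * (\<rho> (s, t) * sapp V W S (ketbra s t) (v, u))"
  \<comment> \<open>Packing two sums into one over pairs lets a single \<open>sum.swap\<close>
    exchange the outer and the inner double sum.\<close>
  have pair: "(\<Sum>p\<in>?I \<times> ?I. g (fst p) (snd p)) = (\<Sum>a\<in>?I. \<Sum>b\<in>?I. g a b)"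
    for g :: "asg \<Rightarrow> asg \<Rightarrow> complex"
    by (simp add: sum.cartesian_product case_prod_unfold)
  have "qtr W (qmult W (heis V W S M) \<rho>) = (\<Sum>t\<in>?I. \<Sum>s\<in>?I. \<Sum>u\<in>?I. \<Sum>v\<in>?I. ?f t s u v)"
    unfolding qtr_qmult
    by (auto simp: heis_def qtr_qmult sum_distrib_left sum_distrib_right mult_ac intro!: sum.cong)
  also have "\<dots> = (\<Sum>s\<in>?I. \<Sum>t\<in>?I. \<Sum>u\<in>?I. \<Sum>v\<in>?I. ?f t s u v)"
    by (rule sum.swap)
  also have "\<dots> = (\<Sum>p\<in>?I \<times> ?I. \<Sum>q\<in>?I \<times> ?I. ?f (snd p) (fst p) (fst q) (snd q))"
    by (simp only: pair [of "\<lambda>s t. \<Sum>u\<in>?I. \<Sum>v\<in>?I. ?f t s u v"]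
        pair [of "\<lambda>u v. ?f t s u v" for s t])
  also have "\<dots> = (\<Sum>q\<in>?I \<times> ?I. \<Sum>p\<in>?I \<times> ?I. ?f (snd p) (fst p) (fst q) (snd q))"
    by (rule sum.swap)
  also have "\<dots> = (\<Sum>u\<in>?I. \<Sum>v\<in>?I. \<Sum>s\<in>?I. \<Sum>t\<in>?I. ?f t s u v)"
    by (simp only: pair [of "\<lambda>u v. \<Sum>s\<in>?I. \<Sum>t\<in>?I. ?f t s u v"]
        pair [of "\<lambda>s t. ?f t s u v" for u v])
  also have "\<dots> = qtr W (qmult W M (sapp V W S \<rho>))"
    unfolding qtr_qmult
    by (subst sapp_ketbra_expand [OF assms, of S \<rho>]) (simp add: sum_distrib_left)
  finally show ?thesis .
qed

text \<open>An adjoint formed once on \<open>W\<close> is correct on every larger \<open>X\<close>,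
  as specifications quantify over all such \<open>X\<close>.\<close>

lemma qtr_ext_op_heis:
  assumes "finite X" "V \<subseteq> W" "W \<subseteq> X"
  shows "qtr X (qmult X (ext_op W X (heis V W S M)) \<rho>) = qtr X (qmult X (ext_op W X M) (sapp V X S \<rho>))"
  using assms finite_subset [OF assms(3,1)] by (simp add: qtr_ext_op qtr_heis ptr_sapp)

lemma effects_complement: "M \<in> effects W \<Longrightarrow> (\<lambda>p. qid W p - M p) \<in> effects W"
  by (simp add: effects_def)

lemma qform_diff: "qform I (\<lambda>p. A p - B p) \<psi> = qform I A \<psi> - qform I B \<psi>"
  by (simp add: qform_def sum_subtractf algebra_simps)

lemma ext_op_self: "wf_op W M \<Longrightarrow> ext_op W W M = M"
proof -
  assume wf: "wf_op W M"
  have "restr W u = u" if "u \<in> asgs W" for u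
    using that by (auto simp: asgs_def restr_def)
  then show ?thesis using wf by (auto simp: ext_op_def wf_op_def restr_def fun_eq_iff)
qed

text \<open>The form of the adjoint at \<open>\<psi>\<close> is the expectation of \<open>M\<close>
  in the output on \<open>proj W \<psi>\<close>, which lies between 0 and the trace of the
  input.\<close>

lemma heis_effect:
  assumes "finite W" "V \<subseteq> W" "S \<in> DProg V" "M \<in> effects W"
  shows "heis V W S M \<in> effects W"
proof -
  have q: "qform (asgs W) (heis V W S M) \<psi> = qtr W (qmult W M (sapp V W S (proj W \<psi>)))" for \<psi>
    by (simp add: qtr_heis [OF assms(1,2)] flip: qtr_qmult_proj)
  have wf: "wf_op W (heis V W S M)" "wf_op W (qid W)"
    by (auto simp: wf_op_def heis_def qid_def)
  have psd: "psd W M" using assms(4) by (simp add: effects_def)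
  have \<sigma>: "psd W (sapp V W S (proj W \<psi>))" for \<psi>
    using DProg_psd(1) [OF assms(3,1,2) psd_proj] .
  have c: "cnonneg (qform (asgs W) (heis V W S M) \<psi>)" for \<psi>
    unfolding q using psd_trace_product [OF assms(1) psd \<sigma>] .
  have "cnonneg (qform (asgs W) (\<lambda>p. qid W p - heis V W S M p) \<psi>)" for \<psi>
  proof -
    have "Re (qtr W (qmult W M (sapp V W S (proj W \<psi>)))) \<le> Re (qtr W (sapp V W S (proj W \<psi>)))"
      using effect_bounds(2) [OF assms(1) order_refl assms(4) \<sigma>] psd by (simp add: ext_op_self psd_iff)
    also have "\<dots> \<le> Re (qtr W (proj W \<psi>))"
      using DProg_psd(2) [OF assms(3,1,2) psd_proj] .
    finally have "Re (qform (asgs W) (heis V W S M) \<psi>) \<le> Re (qtr W (proj W \<psi>))"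
      unfolding q .
    moreover have "qform (asgs W) (qid W) \<psi> = qtr W (proj W \<psi>)"
      using qtr_qmult_qid [OF assms(1)] by (simp flip: qtr_qmult_proj)
    moreover have "cnonneg (qtr W (proj W \<psi>))"
      using qtr_cnonneg [OF assms(1) psd_proj] .
    ultimately show ?thesis
      using c [of \<psi>] by (simp add: qform_diff cnonneg_def)
  qed
  then show ?thesis
    using c wf by (auto simp: effects_def psd_iff pos_form_def wf_op_def)
qed

subsection \<open>Kraus and Choi representations\<close>

text \<open>Conjugation by one operator, whose matrix entry from input \<open>s\<close> to output
  \<open>u\<close> is \<open>K s u\<close>.\<close>

definition kraus :: "nat set \<Rightarrow> (asg \<Rightarrow> asg \<Rightarrow> complex) \<Rightarrow> sop" where
  "kraus V K = (\<lambda>((s, t), (u, v)). if s \<in> asgs V \<and> t \<in> asgs V \<and> u \<in> asgs V \<and> v \<in> asgs V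
     then K s u * cnj (K t v) else 0)"

lemma wf_sop_kraus: "wf_sop V (kraus V K)"
  by (auto simp: wf_sop_def kraus_def)

lemma wf_op_sapp: "wf_op X (sapp V X S \<rho>)"
  by (auto simp: wf_op_def sapp_def)

lemma sum_regroup:
  fixes h :: "'a \<Rightarrow> 'b \<Rightarrow> 'a \<Rightarrow> 'b \<Rightarrow> 'c::comm_monoid_add"
  shows "(\<Sum>w\<in>I. \<Sum>r\<in>J. \<Sum>w'\<in>I. \<Sum>r'\<in>J. h w r w' r')
    = (\<Sum>r\<in>J. \<Sum>r'\<in>J. \<Sum>w\<in>I. \<Sum>w'\<in>I. h w r w' r')"
proof -
  have "(\<Sum>w\<in>I. \<Sum>r\<in>J. \<Sum>w'\<in>I. \<Sum>r'\<in>J. h w r w' r')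
    = (\<Sum>r\<in>J. \<Sum>w\<in>I. \<Sum>w'\<in>I. \<Sum>r'\<in>J. h w r w' r')"
    by (rule sum.swap)
  also have "\<dots> = (\<Sum>r\<in>J. \<Sum>w\<in>I. \<Sum>r'\<in>J. \<Sum>w'\<in>I. h w r w' r')"
    by (intro sum.cong refl sum.swap)
  also have "\<dots> = (\<Sum>r\<in>J. \<Sum>r'\<in>J. \<Sum>w\<in>I. \<Sum>w'\<in>I. h w r w' r')"
    by (intro sum.cong refl sum.swap)
  finally show ?thesis .
qed

text \<open>The form of the output at \<open>\<phi>\<close> equals the form of \<open>\<rho>\<close>
  at the adjoint Kraus operator applied to \<open>\<phi>\<close>.\<close>

lemma CP_kraus: "CP V (kraus V K)"
  unfolding CP_def
proof (intro allI impI)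
  fix X \<rho> assume X: "finite X \<and> V \<subseteq> X" and \<rho>: "psd X \<rho>"
  then have VX: "V \<subseteq> X" by simp
  have "cnonneg (qform (asgs X) (sapp V X (kraus V K) \<rho>) \<phi>)" for \<phi>
  proof -
    \<comment> \<open>The adjoint Kraus operator on \<open>V\<close>, tensored with the identity
      elsewhere, applied to \<open>\<phi>\<close>.\<close>
    define \<xi> where "\<xi> x = (\<Sum>w\<in>asgs V. cnj (K (restr V x) w) * \<phi> (merge V w (restr (X - V) x)))" for x
    let ?I = "asgs V" and ?J = "asgs (X - V)"
    let ?g = "\<lambda>w r w' r' s t. cnj (\<phi> (merge V w r)) * (K s w * cnj (K t w') * \<rho> (merge V s r, merge V t r'))
       * \<phi> (merge V w' r')"
    have "qform (asgs X) (sapp V X (kraus V K) \<rho>) \<phi> =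
      (\<Sum>w\<in>?I. \<Sum>r\<in>?J. \<Sum>w'\<in>?I. \<Sum>r'\<in>?J. \<Sum>s\<in>?I. \<Sum>t\<in>?I. ?g w r w' r' s t)"
      unfolding qform_def sum_asgs_split [OF VX]
      by (intro sum.cong refl) (simp add: sapp_def kraus_def restr_merge_same restr_merge_compl
          merge_in_asgs_compl [OF VX] sum_distrib_left sum_distrib_right)
    also have "\<dots> = (\<Sum>r\<in>?J. \<Sum>r'\<in>?J. \<Sum>w\<in>?I. \<Sum>w'\<in>?I. \<Sum>s\<in>?I. \<Sum>t\<in>?I. ?g w r w' r' s t)"
      by (rule sum_regroup)
    also have "\<dots> = (\<Sum>r\<in>?J. \<Sum>r'\<in>?J. \<Sum>s\<in>?I. \<Sum>t\<in>?I. \<Sum>w\<in>?I. \<Sum>w'\<in>?I. ?g w r w' r' s t)"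
    proof (rule sum.cong [OF refl], rule sum.cong [OF refl])
      fix r r'
      have "(\<Sum>w\<in>?I. \<Sum>w'\<in>?I. \<Sum>s\<in>?I. \<Sum>t\<in>?I. ?g w r w' r' s t) =
        (\<Sum>(w, w')\<in>?I \<times> ?I. \<Sum>(s, t)\<in>?I \<times> ?I. ?g w r w' r' s t)"
        by (simp only: sum.cartesian_product [symmetric])
      also have "\<dots> = (\<Sum>(s, t)\<in>?I \<times> ?I. \<Sum>(w, w')\<in>?I \<times> ?I. ?g w r w' r' s t)"
        unfolding case_prod_unfold by (rule sum.swap)
      finally show "(\<Sum>w\<in>?I. \<Sum>w'\<in>?I. \<Sum>s\<in>?I. \<Sum>t\<in>?I. ?g w r w' r' s t) =
        (\<Sum>s\<in>?I. \<Sum>t\<in>?I. \<Sum>w\<in>?I. \<Sum>w'\<in>?I. ?g w r w' r' s t)"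
        by (simp only: sum.cartesian_product [symmetric])
    qed
    also have "\<dots> = (\<Sum>s\<in>?I. \<Sum>r\<in>?J. \<Sum>t\<in>?I. \<Sum>r'\<in>?J. \<Sum>w\<in>?I. \<Sum>w'\<in>?I. ?g w r w' r' s t)"
      by (rule sum_regroup [symmetric])
    also have "\<dots> = qform (asgs X) \<rho> \<xi>"
      unfolding qform_def sum_asgs_split [OF VX]
      by (intro sum.cong refl) (simp add: \<xi>_def restr_merge_same restr_merge_compl
          sum_distrib_left sum_distrib_right mult_ac)
    finally show ?thesis
      using \<rho> by (simp add: psd_iff pos_form_def)
  qed
  then show "psd X (sapp V X (kraus V K) \<rho>)"
    by (simp add: psd_iff pos_form_def wf_op_sapp)
qed

text \<open>The inserted 0 keeps \<open>Max\<close> meaningful for empty \<open>V\<close>; the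
  successor moves shifted qubits beyond all of \<open>V\<close>.\<close>

definition offset :: "nat set \<Rightarrow> nat" where
  "offset V = Suc (Max (insert 0 V))"

text \<open>The qubits \<open>q + offset V\<close> are a disjoint copy of \<open>V\<close>, serving as reference system.\<close>

definition dbl :: "nat set \<Rightarrow> nat set" where
  "dbl V = V \<union> (\<lambda>q. q + offset V) ` V"

definition copy :: "nat set \<Rightarrow> asg \<Rightarrow> asg" where
  "copy V u = (\<lambda>q. q \<in> V \<and> u (q + offset V))"

text \<open>Inverse to reading off \<open>copy V\<close> and \<open>restr V\<close>. The reference
  half \<open>s\<close> will carry input indices, the half \<open>w\<close> on \<open>V\<close>
  output indices.\<close>

definition join :: "nat set \<Rightarrow> asg \<Rightarrow> asg \<Rightarrow> asg" where
  "join V s w = (\<lambda>q. if q \<in> V then w q else offset V \<le> q \<and> s (q - offset V))"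

text \<open>The maximally entangled state left unnormalised, so that Choi entries are coefficients
  without a dimension factor; it is rescaled when a state is required.\<close>

definition omega :: "nat set \<Rightarrow> qop" where
  "omega V = proj (dbl V) (\<lambda>u. if copy V u = restr V u then 1 else 0)"

definition choi :: "nat set \<Rightarrow> sop \<Rightarrow> qop" where
  "choi V S = sapp V (dbl V) S (omega V)"

lemma finite_dbl [simp]: "finite V \<Longrightarrow> finite (dbl V)"
  by (simp add: dbl_def)

lemma subset_dbl: "V \<subseteq> dbl V"
  by (simp add: dbl_def)

lemma less_offset: "finite V \<Longrightarrow> q \<in> V \<Longrightarrow> q < offset V"
  by (simp add: offset_def less_Suc_eq_le)

lemma add_offset_notin: "finite V \<Longrightarrow> q + offset V \<notin> V"
  using less_offset [of V "q + offset V"] by auto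

lemma copy_in_asgs [simp]: "copy V u \<in> asgs V"
  by (simp add: copy_def asgs_def)

lemma join_in_asgs:
  assumes "s \<in> asgs V" "w \<in> asgs V"
  shows "join V s w \<in> asgs (dbl V)"
  unfolding asgs_def mem_Collect_eq
proof (intro allI impI)
  fix q assume q: "q \<notin> dbl V"
  have "q - offset V \<notin> V" if "offset V \<le> q"
    using q that by (force simp: dbl_def image_iff)
  then show "\<not> join V s w q"
    using q assms by (auto simp: join_def dbl_def asgs_def)
qed

lemma copy_join: "finite V \<Longrightarrow> s \<in> asgs V \<Longrightarrow> copy V (join V s w) = s"
  by (auto simp: copy_def join_def asgs_def add_offset_notin fun_eq_iff)

lemma restr_join: "w \<in> asgs V \<Longrightarrow> restr V (join V s w) = w"
  by (auto simp: restr_def join_def asgs_def fun_eq_iff)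

lemma join_copy_restr:
  assumes "finite V" "u \<in> asgs (dbl V)"
  shows "join V (copy V u) (restr V u) = u"
proof
  fix q
  show "join V (copy V u) (restr V u) q = u q"
  proof (cases "q \<in> dbl V")
    case True
    then show ?thesis
      using add_offset_notin [OF assms(1)] by (auto simp: join_def copy_def restr_def dbl_def)
  next
    case False
    then have "\<not> (offset V \<le> q \<and> q - offset V \<in> V)"
      by (force simp: dbl_def image_iff)
    then show ?thesis
      using False assms(2) by (auto simp: join_def copy_def restr_def dbl_def asgs_def)
  qed
qed

lemma psd_omega: "psd (dbl V) (omega V)"
  unfolding omega_def by (rule psd_proj)

text \<open>Entanglement forces the summation indices to match the reference halves, so the Choi
  matrix is a rearrangement of the coefficients.\<close>

lemma choi_eq:
  assumes "finite V"
  shows "choi V S = (\<lambda>(u, v). if u \<in> asgs (dbl V) \<and> v \<in> asgs (dbl V)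
     then S ((copy V u, copy V v), (restr V u, restr V v)) else 0)"
proof (rule ext, clarify)
  fix u v
  have m: "merge V s (restr (dbl V - V) x) \<in> asgs (dbl V)"
    "restr V (merge V s (restr (dbl V - V) x)) = s" if "s \<in> asgs V" for s x
    using that merge_in_asgs_compl [OF subset_dbl that] by (auto simp: restr_merge_same)
  \<comment> \<open>The super-operator acts on \<open>V\<close> only and leaves the reference half
    alone.\<close>
  have c: "copy V (merge V s (restr (dbl V - V) x)) = copy V x" for s x
    using add_offset_notin [OF assms] by (auto simp: copy_def merge_def restr_def dbl_def)
  have "(\<Sum>s\<in>asgs V. \<Sum>t\<in>asgs V. S ((s, t), (restr V u, restr V v)) *
          omega V (merge V s (restr (dbl V - V) u), merge V t (restr (dbl V - V) v)))
     = (\<Sum>s\<in>asgs V. if copy V u = s then (\<Sum>t\<in>asgs V. if copy V v = t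
           then S ((s, t), (restr V u, restr V v)) else 0) else 0)"
    by (intro sum.cong refl) (auto simp: omega_def proj_def m c intro!: sum.cong)
  also have "\<dots> = S ((copy V u, copy V v), (restr V u, restr V v))"
    using assms by (simp add: sum.delta')
  finally show "choi V S (u, v) = (if u \<in> asgs (dbl V) \<and> v \<in> asgs (dbl V)
     then S ((copy V u, copy V v), (restr V u, restr V v)) else 0)"
    by (simp add: choi_def sapp_def)
qed

lemma choi_join:
  assumes "finite V" "s \<in> asgs V" "t \<in> asgs V" "u \<in> asgs V" "v \<in> asgs V"
  shows "choi V S (join V s u, join V t v) = S ((s, t), (u, v))"
  using assms by (simp add: choi_eq join_in_asgs copy_join restr_join)

lemma psd_choi: "finite V \<Longrightarrow> CP V S \<Longrightarrow> psd (dbl V) (choi V S)"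
  unfolding choi_def CP_def using psd_omega subset_dbl by simp

text \<open>Coefficients are entries of a positive Choi matrix, hence controlled by its trace. This
  yields both compactness and the vanishing of maps with traceless Choi matrix.\<close>

lemma CP_coeff_bound:
  assumes "finite V" "wf_sop V S" "CP V S"
  shows "cmod (S x) \<le> 2 * Re (qtr (dbl V) (choi V S))"
proof -
  let ?I = "asgs (dbl V)"
  have pos: "pos_form ?I (choi V S)" and fin: "finite ?I"
    using psd_choi [OF assms(1,3)] assms(1) by (auto simp: psd_iff)
  have d: "0 \<le> Re (choi V S (a, a))" if "a \<in> ?I" for a
    using pos_form_diag [OF fin pos that] by (simp add: cnonneg_def)
  have diag: "Re (choi V S (a, a)) \<le> Re (qtr (dbl V) (choi V S))" if "a \<in> ?I" for a
    using d member_le_sum [of a ?I "\<lambda>a. Re (choi V S (a, a))"] that fin by (simp add: qtr_def)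
  have 0: "0 \<le> Re (qtr (dbl V) (choi V S))"
    using d by (auto simp: qtr_def intro: sum_nonneg)
  obtain s t u v where x: "x = ((s, t), (u, v))" by (metis surj_pair)
  show ?thesis
  proof (cases "s \<in> asgs V \<and> t \<in> asgs V \<and> u \<in> asgs V \<and> v \<in> asgs V")
    case True
    then have j: "join V s u \<in> ?I" "join V t v \<in> ?I" by (auto intro: join_in_asgs)
    have "cmod (S x) = cmod (choi V S (join V s u, join V t v))"
      using True assms(1) by (simp add: choi_join x)
    also have "\<dots> \<le> Re (choi V S (join V s u, join V s u)) + Re (choi V S (join V t v, join V t v))"
      by (rule pos_form_entry_bound [OF fin pos j])
    also have "\<dots> \<le> 2 * Re (qtr (dbl V) (choi V S))"
      using diag [OF j(1)] diag [OF j(2)] by simp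
    finally show ?thesis .
  next
    case False
    then show ?thesis using assms(2) 0 unfolding wf_sop_def x by (metis norm_zero mult_nonneg_nonneg zero_le_numeral)
  qed
qed

lemma DProg_coeff_bound:
  assumes "finite V" "S \<in> DProg V"
  shows "cmod (S x) \<le> 2 * Re (qtr (dbl V) (omega V))"
proof -
  have "cmod (S x) \<le> 2 * Re (qtr (dbl V) (choi V S))"
    using CP_coeff_bound assms by (simp add: DProg_def)
  also have "Re (qtr (dbl V) (choi V S)) \<le> Re (qtr (dbl V) (omega V))"
    unfolding choi_def using DProg_psd(2) assms psd_omega subset_dbl by simp
  finally show ?thesis by simp
qed

text \<open>The Choi matrix of the difference has trace zero, and \<open>CP_coeff_bound\<close> then
  annihilates every coefficient.\<close>

lemma trace_pres_sle_eq:
  assumes "finite V" "S \<in> DProg V" "T \<in> DProg V" "trace_pres V S" "trace_pres V T" "sle V S T"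
  shows "S = T"
proof -
  have wf: "wf_sop V S" "wf_sop V T" using assms by (auto simp: DProg_def)
  have wfd: "wf_sop V (\<lambda>x. T x - S x)"
    using wf by (simp add: wf_sop_def)
  have "qtr (dbl V) (choi V (\<lambda>x. T x - S x)) = qtr (dbl V) (choi V T) - qtr (dbl V) (choi V S)"
    by (simp add: choi_def sapp_diff_left qtr_diff)
  also have "\<dots> = 0"
    using trace_pres_psd assms psd_omega subset_dbl by (simp add: choi_def)
  finally have "cmod (T x - S x) \<le> 0" for x
    using CP_coeff_bound [OF assms(1) wfd, of x] assms(6) by (simp add: sle_def)
  then show ?thesis by (simp add: fun_eq_iff)
qed

subsection \<open>Separation from the completely positive cone\<close>

text \<open>The real part makes the coefficient space a real Euclidean space, the setting for
  nearest points and separation.\<close>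

definition sop_ip :: "nat set \<Rightarrow> sop \<Rightarrow> sop \<Rightarrow> real" where
  "sop_ip V S T = Re (\<Sum>x\<in>(asgs V \<times> asgs V) \<times> (asgs V \<times> asgs V). cnj (S x) * T x)"

lemma sop_ip_add_right: "sop_ip V S (\<lambda>x. T x + U x) = sop_ip V S T + sop_ip V S U"
  by (simp add: sop_ip_def sum.distrib algebra_simps)

lemma sop_ip_scale_right: "sop_ip V S (\<lambda>x. of_real r * T x) = r * sop_ip V S T"
proof -
  have "(\<Sum>x\<in>(asgs V \<times> asgs V) \<times> (asgs V \<times> asgs V). cnj (S x) * (of_real r * T x))
     = of_real r * (\<Sum>x\<in>(asgs V \<times> asgs V) \<times> (asgs V \<times> asgs V). cnj (S x) * T x)"
    by (simp add: sum_distrib_left mult_ac)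
  then show ?thesis by (simp add: sop_ip_def)
qed

lemma sop_ip_commute: "sop_ip V S T = sop_ip V T S"
  by (simp add: sop_ip_def mult.commute)

lemma sop_ip_self: "sop_ip V S S = (\<Sum>x\<in>(asgs V \<times> asgs V) \<times> (asgs V \<times> asgs V). (cmod (S x))\<^sup>2)"
  unfolding cmod_power2 by (simp add: sop_ip_def power2_eq_square)

lemma sop_ip_self_nonneg: "0 \<le> sop_ip V S S"
  by (simp add: sop_ip_self sum_nonneg)

lemma sop_ip_self_eq_0:
  assumes "finite V" "wf_sop V S" "sop_ip V S S = 0"
  shows "S = (\<lambda>x. 0)"
proof (rule ext, clarify)
  fix s t u v
  show "S ((s, t), (u, v)) = 0"
  proof (cases "s \<in> asgs V \<and> t \<in> asgs V \<and> u \<in> asgs V \<and> v \<in> asgs V")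
    case True
    have "\<forall>x\<in>(asgs V \<times> asgs V) \<times> (asgs V \<times> asgs V). (cmod (S x))\<^sup>2 = 0"
      using assms(1,3) unfolding sop_ip_self by (subst (asm) sum_nonneg_eq_0_iff) auto
    then show ?thesis using True by auto
  qed (use assms(2) in \<open>auto simp: wf_sop_def\<close>)
qed

lemma sop_ip_self_add_scale:
  "sop_ip V (\<lambda>x. S x + of_real r * T x) (\<lambda>x. S x + of_real r * T x)
     = sop_ip V S S + 2 * r * sop_ip V S T + r\<^sup>2 * sop_ip V T T"
  by (simp add: sop_ip_add_right sop_ip_scale_right sop_ip_commute [of V "\<lambda>x. S x + of_real r * T x"]
      sop_ip_commute [of V T S] power2_eq_square algebra_simps)

text \<open>Hermiticity of the Choi matrix of \<open>P\<close> converts the trace pairing into the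
  Hilbert-Schmidt inner product of the coefficients.\<close>

lemma qtr_choi_product:
  assumes "finite V"
    and herm: "\<And>u v. u \<in> asgs (dbl V) \<Longrightarrow> v \<in> asgs (dbl V) \<Longrightarrow> choi V P (v, u) = cnj (choi V P (u, v))"
  shows "Re (qtr (dbl V) (qmult (dbl V) (choi V P) (choi V S))) = sop_ip V P S"
proof -
  let ?I = "asgs (dbl V)" and ?A = "asgs V"
  have "qtr (dbl V) (qmult (dbl V) (choi V P) (choi V S))
      = (\<Sum>u\<in>?I. \<Sum>v\<in>?I. cnj (choi V P (v, u)) * choi V S (v, u))"
    unfolding qtr_qmult
  proof (intro sum.cong refl)
    fix u v assume "u \<in> ?I" "v \<in> ?I"
    then have "choi V P (u, v) = cnj (choi V P (v, u))" using herm by blast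
    then show "choi V P (u, v) * choi V S (v, u) = cnj (choi V P (v, u)) * choi V S (v, u)"
      by simp
  qed
  also have "\<dots> = (\<Sum>(u, v)\<in>?I \<times> ?I. cnj (choi V P (v, u)) * choi V S (v, u))"
    by (simp add: sum.cartesian_product)
  \<comment> \<open>The reindexing swaps \<open>u\<close> and \<open>v\<close>, since the summand
    contains the entry \<open>(v, u)\<close>.\<close>
  also have "\<dots> = (\<Sum>x\<in>(?A \<times> ?A) \<times> (?A \<times> ?A). cnj (P x) * S x)"
    by (rule sum.reindex_bij_witness [where
          j = "\<lambda>(u, v). ((copy V v, copy V u), (restr V v, restr V u))" and
          i = "\<lambda>((s, t), (a, b)). (join V t b, join V s a)"])
      (use assms(1) in \<open>auto simp: join_copy_restr copy_join restr_join join_in_asgs choi_eq\<close>)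
  finally show ?thesis by (simp add: sop_ip_def)
qed

text \<open>Every rank-one positive operator on the doubled system is thus the Choi matrix of a
  completely positive map, so the cone contains enough elements to test positivity.\<close>

lemma choi_kraus:
  assumes "finite V"
  shows "choi V (kraus V (\<lambda>s w. \<phi> (join V s w))) = proj (dbl V) \<phi>"
  using assms by (auto simp: choi_eq kraus_def proj_def join_copy_restr fun_eq_iff)

lemma hermitian_qform_real:
  assumes "\<And>u v. u \<in> I \<Longrightarrow> v \<in> I \<Longrightarrow> M (v, u) = cnj (M (u, v))"
  shows "Im (qform I M \<psi>) = 0"
proof -
  have "cnj (qform I M \<psi>) = (\<Sum>u\<in>I. \<Sum>v\<in>I. \<psi> u * M (v, u) * cnj (\<psi> v))"
    unfolding qform_def cnj_sum
  proof (intro sum.cong refl)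
    fix u v assume "u \<in> I" "v \<in> I"
    then have "M (v, u) = cnj (M (u, v))" by (rule assms)
    then show "cnj (cnj (\<psi> u) * M (u, v) * \<psi> v) = \<psi> u * M (v, u) * cnj (\<psi> v)" by simp
  qed
  also have "\<dots> = (\<Sum>v\<in>I. \<Sum>u\<in>I. \<psi> u * M (v, u) * cnj (\<psi> v))"
    by (rule sum.swap)
  also have "\<dots> = qform I M \<psi>"
    by (simp add: qform_def mult_ac)
  finally show ?thesis by (simp add: complex_eq_iff)
qed

text \<open>The sum of the moduli of all entries bounds the form on unit vectors; dividing by one
  plus that sum puts \<open>H\<close> below the identity.\<close>

lemma psd_scaled_effect:
  assumes "finite W" "psd W H"
  obtains c where "c > 0" "(\<lambda>p. of_real c * H p) \<in> effects W"
proof -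
  let ?I = "asgs W"
  define h where "h = (\<Sum>u\<in>?I. \<Sum>v\<in>?I. cmod (H (u, v)))"
  have h: "h \<ge> 0" by (simp add: h_def sum_nonneg)
  define c where "c = 1 / (1 + h)"
  have c: "c > 0" "c * h \<le> 1" using h by (auto simp: c_def)
  have bound: "Re (qform ?I H \<psi>) \<le> h * (\<Sum>u\<in>?I. (cmod (\<psi> u))\<^sup>2)" for \<psi>
  proof -
    let ?N = "\<Sum>u\<in>?I. (cmod (\<psi> u))\<^sup>2"
    have le: "(cmod (\<psi> u))\<^sup>2 \<le> ?N" if "u \<in> ?I" for u
      using that assms(1) by (intro member_le_sum) auto
    have "cmod (\<psi> u) * cmod (\<psi> v) \<le> ?N" if "u \<in> ?I" "v \<in> ?I" for u v
      using le [OF that(1)] le [OF that(2)] sum_squares_bound [of "cmod (\<psi> u)" "cmod (\<psi> v)"] by simp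
    then have "cmod (cnj (\<psi> u) * H (u, v) * \<psi> v) \<le> cmod (H (u, v)) * ?N"
      if "u \<in> ?I" "v \<in> ?I" for u v
      using mult_left_mono [of "cmod (\<psi> u) * cmod (\<psi> v)" ?N "cmod (H (u, v))"] that
      by (simp add: norm_mult mult_ac)
    then have "cmod (qform ?I H \<psi>) \<le> (\<Sum>u\<in>?I. \<Sum>v\<in>?I. cmod (H (u, v)) * ?N)"
      unfolding qform_def by (intro sum_norm_le) blast
    also have "\<dots> = h * ?N"
      by (simp add: h_def sum_distrib_right)
    finally show ?thesis
      using complex_Re_le_cmod [of "qform ?I H \<psi>"] by linarith
  qed
  have psd: "psd W (\<lambda>p. of_real c * H p)"
    using psd_scale [of c] c(1) assms(2) by simp
  have "cnonneg (qform ?I (\<lambda>p. qid W p - of_real c * H p) \<psi>)" for \<psi>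
  proof -
    let ?N = "\<Sum>u\<in>?I. (cmod (\<psi> u))\<^sup>2"
    have id: "qform ?I (qid W) \<psi> = of_real ?N"
    proof -
      have "qform ?I (qid W) \<psi> = qtr W (proj W \<psi>)"
        using qtr_qmult_qid [OF assms(1)] by (simp flip: qtr_qmult_proj)
      also have "\<dots> = of_real ?N"
        by (simp add: qtr_def proj_def complex_norm_square [symmetric] del: of_real_power)
      finally show ?thesis .
    qed
    have sc: "qform ?I (\<lambda>p. of_real c * H p) \<psi> = of_real c * qform ?I H \<psi>"
      by (simp add: qform_def sum_distrib_left mult_ac)
    have "c * Re (qform ?I H \<psi>) \<le> c * (h * ?N)"
      using bound c(1) by (intro mult_left_mono) auto
    also have "\<dots> \<le> ?N"
      using mult_right_mono [OF c(2), of ?N] by (simp add: sum_nonneg mult_ac)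
    finally show ?thesis
      using assms(2) unfolding qform_diff id
      by (simp add: sc psd_iff pos_form_def cnonneg_def del: of_real_sum)
  qed
  moreover have "wf_op W (\<lambda>p. qid W p - of_real c * H p)"
    using assms(2) by (auto simp: psd_def wf_op_def qid_def)
  ultimately have "(\<lambda>p. of_real c * H p) \<in> effects W"
    using psd by (simp add: effects_def psd_iff pos_form_def)
  with c(1) that show ?thesis by blast
qed

section \<open>Compactness in the product topology and nearest points\<close>

lemma continuous_on_coordinate:
  fixes f :: "'a::topological_space \<Rightarrow> 'b \<Rightarrow> 'c::topological_space"
  shows "continuous_on U f \<Longrightarrow> continuous_on U (\<lambda>p. f p x)"
  by (rule continuous_on_product_then_coordinatewise)

text \<open>A product of closed discs, compact by Tychonoff.\<close>

lemma compact_bounded_funs: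
  "compact {S :: 'a \<Rightarrow> complex. \<forall>x. cmod (S x) \<le> B}"
proof -
  have "compactin (product_topology (\<lambda>_. euclidean) UNIV) (PiE UNIV (\<lambda>_ :: 'a. cball (0 :: complex) B))"
    by (simp add: compactin_PiE)
  moreover have "PiE UNIV (\<lambda>_ :: 'a. cball (0 :: complex) B) = {S. \<forall>x. cmod (S x) \<le> B}"
    by (auto simp: PiE_def Pi_def)
  ultimately show ?thesis
    by (simp add: euclidean_product_topology)
qed

lemma closed_wf_sop: "closed {S. wf_sop V S}"
  unfolding wf_sop_def
  by (intro closed_Collect_all closed_Collect_imp open_Collect_const closed_Collect_eq
      continuous_on_product_coordinates continuous_intros)

text \<open>Complete positivity is an intersection of closed conditions, each on a continuous
  function of the coefficients.\<close>

lemma closed_CP: "closed {S. CP V S}"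
proof -
  have c: "continuous_on UNIV (\<lambda>S. sapp V X S \<rho> p)" for X \<rho> p
    by (cases p, cases "fst p \<in> asgs X \<and> snd p \<in> asgs X")
      (auto simp: sapp_def intro!: continuous_intros)
  have q: "continuous_on UNIV (\<lambda>S. qform (asgs X) (sapp V X S \<rho>) \<psi>)" for X \<rho> \<psi>
    unfolding qform_def by (intro continuous_intros c)
  show ?thesis
    unfolding CP_def psd_iff pos_form_def cnonneg_def
    by (intro closed_Collect_all closed_Collect_imp open_Collect_const closed_Collect_conj
        closed_Collect_eq closed_Collect_le continuous_intros q) (simp add: wf_op_sapp)
qed

text \<open>A point of least norm in the sum of \<open>K\<close> and the completely positive cone.
  The cone is unbounded, so the minimum is taken over bounded cone elements and then shown to be
  global.\<close>

lemma sop_closest_point: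
  assumes "finite V" "K \<noteq> {}" "compact K" "\<And>D x. D \<in> K \<Longrightarrow> cmod (D x) \<le> B"
  obtains D\<^sub>0 C\<^sub>0 where "D\<^sub>0 \<in> K" "wf_sop V C\<^sub>0" "CP V C\<^sub>0"
    "\<forall>D\<in>K. \<forall>C. wf_sop V C \<and> CP V C \<longrightarrow>
      sop_ip V (\<lambda>x. D\<^sub>0 x + C\<^sub>0 x) (\<lambda>x. D\<^sub>0 x + C\<^sub>0 x) \<le> sop_ip V (\<lambda>x. D x + C x) (\<lambda>x. D x + C x)"
proof -
  let ?Q = "(asgs V \<times> asgs V) \<times> (asgs V \<times> asgs V)"
  define f where "f D C = sop_ip V (\<lambda>x. D x + C x) (\<lambda>x. D x + C x)" for D C :: sop
  obtain D\<^sub>1 where D1: "D\<^sub>1 \<in> K" using assms(2) by blast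
  \<comment> \<open>If a coefficient of \<open>C\<close> exceeds \<open>R\<close>, adding any
    \<open>D\<close> from \<open>K\<close> leaves it above the norm of \<open>D\<^sub>1\<close>, so
    \<open>C\<close> does no better than the zero map paired with \<open>D\<^sub>1\<close>.\<close>
  define R where "R = sqrt (f D\<^sub>1 (\<lambda>x. 0)) + B"
  have B: "B \<ge> 0" using assms(4) [OF D1] norm_ge_zero order_trans by blast
  have f0: "f D C \<ge> 0" for D C by (simp add: f_def sop_ip_self_nonneg)
  then have R: "R \<ge> 0" using B by (simp add: R_def)
  define \<C> where "\<C> = {C. \<forall>x. cmod (C x) \<le> R} \<inter> ({C. wf_sop V C} \<inter> {C. CP V C})"
  have "compact \<C>"
    unfolding \<C>_def by (intro compact_Int_closed compact_bounded_funs closed_Int closed_wf_sop closed_CP)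
  then have "compact (K \<times> \<C>)" using assms(3) by (rule compact_Times [rotated])
  moreover have zero: "(\<lambda>x. 0) \<in> \<C>"
    using R by (simp add: \<C>_def CP_zero wf_sop_def)
  moreover have "continuous_on (K \<times> \<C>) (\<lambda>p. f (fst p) (snd p))"
    unfolding f_def sop_ip_self by (intro continuous_intros continuous_on_coordinate)
  ultimately obtain p where p: "p \<in> K \<times> \<C>" "\<And>q. q \<in> K \<times> \<C> \<Longrightarrow> f (fst p) (snd p) \<le> f (fst q) (snd q)"
    using D1 continuous_attains_inf [of "K \<times> \<C>" "\<lambda>p. f (fst p) (snd p)"] by blast
  have "f (fst p) (snd p) \<le> f D C" if D: "D \<in> K" and C: "wf_sop V C" "CP V C" for D C
  proof (cases "C \<in> \<C>")
    case True
    then show ?thesis using p(2) [of "(D, C)"] D by simp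
  next
    case False
    then obtain x where x: "cmod (C x) > R"
      using C by (auto simp: \<C>_def not_le)
    then have "C x \<noteq> 0" using R by auto
    \<comment> \<open>Well-formed maps vanish off the finite index set, so the large coefficient
      does count in the norm.\<close>
    then have xQ: "x \<in> ?Q"
      using C(1) by (cases x) (force simp: wf_sop_def)
    have "cmod (C x) \<le> cmod (D x + C x) + cmod (D x)"
      using norm_triangle_ineq4 [of "D x + C x" "D x"] by simp
    then have "sqrt (f D\<^sub>1 (\<lambda>x. 0)) \<le> cmod (D x + C x)"
      using x assms(4) [OF D, of x] by (simp add: R_def)
    then have "f D\<^sub>1 (\<lambda>x. 0) \<le> (cmod (D x + C x))\<^sup>2"
      using f0 by (simp add: real_le_rsqrt sqrt_le_D)
    also have "\<dots> \<le> f D C"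
      unfolding f_def sop_ip_self using xQ assms(1)
      by (intro member_le_sum [of x ?Q "\<lambda>x. (cmod (D x + C x))\<^sup>2"]) auto
    finally show ?thesis
      using p(2) [of "(D\<^sub>1, \<lambda>x. 0)"] D1 zero by simp
  qed
  then show ?thesis
    using that [of "fst p" "snd p"] p(1) by (auto simp: \<C>_def f_def)
qed

text \<open>The first-order condition at a minimum: for small \<open>t\<close> the linear term
  dominates.\<close>

lemma nonneg_of_quadratic:
  fixes a b :: real
  assumes "b \<ge> 0" "\<And>t. 0 < t \<Longrightarrow> t \<le> 1 \<Longrightarrow> 0 \<le> 2 * t * a + t\<^sup>2 * b"
  shows "0 \<le> a"
proof (rule ccontr)
  assume "\<not> 0 \<le> a"
  define t where "t = min 1 (- a / (b + 1))"
  have t: "0 < t" "t \<le> 1"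
    using \<open>\<not> 0 \<le> a\<close> assms(1) divide_neg_pos [of a "b + 1"] by (auto simp: t_def)
  have t': "t * (b + 1) \<le> - a"
    using assms(1) pos_le_divide_eq [of "b + 1" t "- a"] by (simp add: t_def)
  have "0 \<le> t * (2 * a + t * b)"
    using assms(2) [OF t(1,2)] by (simp add: power2_eq_square algebra_simps)
  then have "0 \<le> 2 * a + t * b" using t(1) by (simp add: zero_le_mult_iff)
  then show False using t t' \<open>\<not> 0 \<le> a\<close> by (simp add: algebra_simps)
qed

text \<open>The nearest point \<open>P\<close> serves as the separating functional. Minimality makes
  it nonnegative on the cone and at least its squared norm on \<open>K\<close>; nonnegativity on the
  cone makes its Choi matrix positive.\<close>

lemma sop_separation:
  assumes V: "finite V" and K: "K \<noteq> {}" "compact K" "convex_sops K"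
    and bnd: "\<And>D x. D \<in> K \<Longrightarrow> cmod (D x) \<le> B"
    and wf: "\<And>D. D \<in> K \<Longrightarrow> wf_sop V D"
    and herm: "\<And>D u v. D \<in> K \<Longrightarrow> u \<in> asgs (dbl V) \<Longrightarrow> v \<in> asgs (dbl V) \<Longrightarrow>
      choi V D (v, u) = cnj (choi V D (u, v))"
    and disj: "\<And>D. D \<in> K \<Longrightarrow> \<not> CP V (\<lambda>x. - D x)"
  obtains H \<epsilon> where "H \<in> effects (dbl V)" "\<epsilon> > 0"
    "\<And>D. D \<in> K \<Longrightarrow> \<epsilon> \<le> Re (qtr (dbl V) (qmult (dbl V) H (choi V D)))"
proof -
  let ?I = "asgs (dbl V)"
  obtain D\<^sub>0 C\<^sub>0 where D0: "D\<^sub>0 \<in> K" and C0: "wf_sop V C\<^sub>0" "CP V C\<^sub>0"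
    and min: "\<forall>D\<in>K. \<forall>C. wf_sop V C \<and> CP V C \<longrightarrow>
      sop_ip V (\<lambda>x. D\<^sub>0 x + C\<^sub>0 x) (\<lambda>x. D\<^sub>0 x + C\<^sub>0 x) \<le> sop_ip V (\<lambda>x. D x + C x) (\<lambda>x. D x + C x)"
    using bnd by (rule sop_closest_point [of V K B, OF V K(1,2)])
  define P where "P = (\<lambda>x. D\<^sub>0 x + C\<^sub>0 x)"
  have Pwf: "wf_sop V P"
    using wf [OF D0] C0(1) by (simp add: P_def wf_sop_def)
  \<comment> \<open>If the origin were attained, the negative of \<open>D\<^sub>0\<close> would be
    the completely positive \<open>C\<^sub>0\<close>, against \<open>disj\<close>.\<close>
  have Ppos: "sop_ip V P P > 0"
  proof (rule ccontr)
    assume "\<not> sop_ip V P P > 0"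
    then have "P = (\<lambda>x. 0)"
      using sop_ip_self_eq_0 [OF V Pwf] sop_ip_self_nonneg [of V P] by simp
    then have "C\<^sub>0 = (\<lambda>x. - D\<^sub>0 x)"
      by (auto simp: P_def fun_eq_iff add_eq_0_iff)
    then show False using C0(2) disj [OF D0] by simp
  qed
  \<comment> \<open>First-order optimality along the segment from \<open>P\<close> towards
    \<open>D + C\<close>, which stays in the set by convexity.\<close>
  have var: "sop_ip V P P \<le> sop_ip V P (\<lambda>x. D x + C x)" if D: "D \<in> K" and C: "wf_sop V C" "CP V C" for D C
  proof -
    define Z where "Z = (\<lambda>x. D x + C x - P x)"
    have "0 \<le> 2 * t * sop_ip V P Z + t\<^sup>2 * sop_ip V Z Z" if t: "0 < t" "t \<le> 1" for t
    proof -
      let ?D = "\<lambda>x. of_real t * D x + of_real (1 - t) * D\<^sub>0 x"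
      let ?C = "\<lambda>x. of_real t * C x + of_real (1 - t) * C\<^sub>0 x"
      have "?D \<in> K" using K(3) D D0 t by (simp add: convex_sops_def)
      moreover have "wf_sop V ?C" using C C0 by (simp add: wf_sop_def)
      moreover have "CP V ?C" using C C0 t by (intro CP_add CP_scale) auto
      ultimately have "sop_ip V P P \<le> sop_ip V (\<lambda>x. ?D x + ?C x) (\<lambda>x. ?D x + ?C x)"
        unfolding P_def using min [rule_format, of ?D ?C] by blast
      also have "(\<lambda>x. ?D x + ?C x) = (\<lambda>x. P x + of_real t * Z x)"
        by (simp add: P_def Z_def algebra_simps)
      finally show ?thesis by (simp add: sop_ip_self_add_scale)
    qed
    then have "0 \<le> sop_ip V P Z"
      using nonneg_of_quadratic sop_ip_self_nonneg by blast
    moreover have "sop_ip V P Z + sop_ip V P P = sop_ip V P (\<lambda>x. D x + C x)"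
      unfolding sop_ip_add_right [symmetric] by (simp add: Z_def)
    ultimately show ?thesis by simp
  qed
  have cone: "0 \<le> sop_ip V P C" if C: "wf_sop V C" "CP V C" for C
  proof (rule ccontr)
    assume neg: "\<not> 0 \<le> sop_ip V P C"
    \<comment> \<open>This multiple of \<open>C\<close> cancels the inner product with
      \<open>D\<^sub>0\<close>, giving a value at most 0 where \<open>var\<close> demands a positive
      one.\<close>
    define n where "n = \<bar>sop_ip V P D\<^sub>0\<bar> / - sop_ip V P C"
    have n: "n \<ge> 0" unfolding n_def using neg by (intro divide_nonneg_pos) auto
    have "sop_ip V P P \<le> sop_ip V P (\<lambda>x. D\<^sub>0 x + of_real n * C x)"
      using n C by (intro var [OF D0] CP_scale) (auto simp: wf_sop_def)
    also have "\<dots> = sop_ip V P D\<^sub>0 + n * sop_ip V P C"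
      by (simp add: sop_ip_add_right sop_ip_scale_right)
    also have "n * sop_ip V P C = - \<bar>sop_ip V P D\<^sub>0\<bar>"
      using neg by (simp add: n_def)
    finally show False using Ppos by simp
  qed
  have Kpos: "sop_ip V P P \<le> sop_ip V P D" if "D \<in> K" for D
    using var [OF that, of "\<lambda>x. 0"] by (simp add: wf_sop_def CP_zero)
  have Pherm: "choi V P (v, u) = cnj (choi V P (u, v))" if "u \<in> ?I" "v \<in> ?I" for u v
  proof -
    have "choi V C\<^sub>0 (v, u) = cnj (choi V C\<^sub>0 (u, v))"
      using psd_choi [OF V C0(2)] V that by (intro pos_form_hermitian) (auto simp: psd_iff)
    then show ?thesis
      using herm [OF D0 that] by (simp add: P_def choi_def sapp_add_left)
  qed
  \<comment> \<open>Rank-one Kraus maps test the form at every vector through \<open>cone\<close>;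
    that controls the real part, and hermiticity removes the imaginary part.\<close>
  have "cnonneg (qform ?I (choi V P) \<phi>)" for \<phi>
  proof -
    let ?C = "kraus V (\<lambda>s w. \<phi> (join V s w))"
    have "Re (qform ?I (choi V P) \<phi>) = sop_ip V P ?C"
      using qtr_choi_product [of V P, OF V Pherm, where S = ?C] by (simp add: choi_kraus [OF V] qtr_qmult_proj)
    then show ?thesis
      using cone [OF wf_sop_kraus CP_kraus] hermitian_qform_real [of ?I "choi V P", OF Pherm]
      by (simp add: cnonneg_def)
  qed
  then have "psd (dbl V) (choi V P)"
    by (simp add: psd_iff pos_form_def choi_def wf_op_sapp)
  then obtain c where c: "c > 0" "(\<lambda>p. of_real c * choi V P p) \<in> effects (dbl V)"
    using psd_scaled_effect [OF finite_dbl [OF V]] by blast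
  show ?thesis
  proof
    show "(\<lambda>p. of_real c * choi V P p) \<in> effects (dbl V)" by (rule c(2))
    show "c * sop_ip V P P > 0" using c(1) Ppos by simp
    show "c * sop_ip V P P \<le> Re (qtr (dbl V) (qmult (dbl V) (\<lambda>p. of_real c * choi V P p) (choi V D)))"
      if "D \<in> K" for D
      using Kpos [OF that] c(1) qtr_choi_product [of V P, OF V Pherm, where S = D]
      by (simp add: qtr_qmult_scale_left)
  qed
qed

lemma NProg_D:
  assumes "A \<in> NProg V"
  shows "A \<noteq> {}" "A \<subseteq> DProg V" "convex_sops A" "closed A"
  using assms by (auto simp: NProg_def)

text \<open>Trace non-increase bounds all coefficients uniformly, so closedness suffices for
  compactness.\<close>

lemma compact_NProg:
  assumes "finite V" "A \<in> NProg V"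
  shows "compact A"
proof -
  let ?B = "2 * Re (qtr (dbl V) (omega V))"
  have "A \<subseteq> {S. \<forall>x. cmod (S x) \<le> ?B}"
    using DProg_coeff_bound [OF assms(1)] NProg_D(2) [OF assms(2)] by blast
  moreover have "compact ({S. \<forall>x. cmod (S x) \<le> ?B} \<inter> A)"
    by (rule compact_Int_closed [OF compact_bounded_funs NProg_D(4) [OF assms(2)]])
  ultimately show ?thesis by (simp only: Int_absorb1)
qed

lemma choi_hermitian:
  assumes "finite V" "CP V S" "u \<in> asgs (dbl V)" "v \<in> asgs (dbl V)"
  shows "choi V S (v, u) = cnj (choi V S (u, v))"
  using psd_choi [OF assms(1,2)] assms(1,3,4) by (intro pos_form_hermitian) (auto simp: psd_iff)

text \<open>The sign \<open>\<sigma>\<close> lets one separation serve both orders: \<open>\<sigma> = 1\<close> for Smyth, \<open>\<sigma> = -1\<close> for Hoare.\<close>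

lemma NProg_separation:
  fixes \<sigma> :: real
  assumes V: "finite V" and A: "A \<in> NProg V" and T: "T \<in> DProg V"
    and disj: "\<And>S. S \<in> A \<Longrightarrow> \<not> CP V (\<lambda>x. of_real \<sigma> * (T x - S x))"
  obtains H \<epsilon> where "H \<in> effects (dbl V)" "\<epsilon> > 0"
    "\<And>S. S \<in> A \<Longrightarrow> \<epsilon> \<le> \<sigma> * (Re (qtr (dbl V) (qmult (dbl V) H (choi V S)))
        - Re (qtr (dbl V) (qmult (dbl V) H (choi V T))))"
proof -
  note NP = NProg_D [OF A]
  \<comment> \<open>The negative of \<open>d S\<close> is the map that \<open>disj\<close> denies to
    be completely positive, as \<open>sop_separation\<close> requires.\<close>
  define d :: "sop \<Rightarrow> sop" where "d S = (\<lambda>x. of_real \<sigma> * (S x - T x))" for S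
  let ?B = "2 * Re (qtr (dbl V) (omega V))"
  have choi_d: "choi V (d S) p = of_real \<sigma> * (choi V S p - choi V T p)" for S p
    by (simp add: d_def choi_def sapp_scale_left sapp_diff_left)
  obtain H \<epsilon> where H: "H \<in> effects (dbl V)" "\<epsilon> > 0"
    and sep: "\<And>D. D \<in> d ` A \<Longrightarrow> \<epsilon> \<le> Re (qtr (dbl V) (qmult (dbl V) H (choi V D)))"
  proof (rule sop_separation [of V "d ` A" "\<bar>\<sigma>\<bar> * (?B + ?B)"])
    show "finite V" by (rule V)
    show "d ` A \<noteq> {}" using NP by simp
    show "compact (d ` A)"
    proof (rule compact_continuous_image [OF _ compact_NProg [OF V A]])
      have "continuous_on A (\<lambda>S. S x)" for x
        by (rule continuous_on_subset [OF continuous_on_product_coordinates]) simp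
      then show "continuous_on A d"
        unfolding d_def
        by (intro continuous_on_coordinatewise_then_product continuous_on_mult continuous_on_diff
            continuous_on_const)
    qed
    show "convex_sops (d ` A)"
      unfolding convex_sops_def
    proof (intro ballI allI impI)
      fix D D' and l :: real
      assume "D \<in> d ` A" "D' \<in> d ` A" and l: "0 \<le> l \<and> l \<le> 1"
      then obtain S S' where S: "S \<in> A" "S' \<in> A" "D = d S" "D' = d S'" by blast
      have "(\<lambda>x. of_real l * D x + of_real (1 - l) * D' x)
          = d (\<lambda>x. of_real l * S x + of_real (1 - l) * S' x)"
        unfolding S d_def by (simp add: fun_eq_iff algebra_simps)
      moreover have "(\<lambda>x. of_real l * S x + of_real (1 - l) * S' x) \<in> A"
        using NP(3) S(1,2) l unfolding convex_sops_def by blast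
      ultimately show "(\<lambda>x. of_real l * D x + of_real (1 - l) * D' x) \<in> d ` A" by blast
    qed
    show "cmod (D x) \<le> \<bar>\<sigma>\<bar> * (?B + ?B)" if "D \<in> d ` A" for D x
    proof -
      obtain S where S: "S \<in> DProg V" "D = d S" using \<open>D \<in> d ` A\<close> NP(2) by blast
      have "cmod (S x - T x) \<le> ?B + ?B"
        using norm_triangle_ineq4 [of "S x" "T x"] DProg_coeff_bound [OF V S(1), of x]
          DProg_coeff_bound [OF V T, of x] by linarith
      then show ?thesis
        unfolding S(2) d_def norm_mult norm_of_real by (rule mult_left_mono) simp
    qed
    show "wf_sop V D" if "D \<in> d ` A" for D
      using that NP(2) T by (auto simp: DProg_def wf_sop_def d_def)
    show "choi V D (v, u) = cnj (choi V D (u, v))"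
      if "D \<in> d ` A" and uv: "u \<in> asgs (dbl V)" "v \<in> asgs (dbl V)" for D u v
    proof -
      obtain S where S: "S \<in> DProg V" "D = d S" using \<open>D \<in> d ` A\<close> NP(2) by blast
      then have "CP V S" "CP V T" using T by (auto simp: DProg_def)
      from this [THEN choi_hermitian [OF V _ uv]] show ?thesis
        by (simp add: S(2) choi_d)
    qed
    show "\<not> CP V (\<lambda>x. - D x)" if "D \<in> d ` A" for D
    proof -
      obtain S where S: "S \<in> A" "D = d S" using \<open>D \<in> d ` A\<close> by blast
      have "(\<lambda>x. - D x) = (\<lambda>x. of_real \<sigma> * (T x - S x))"
        unfolding S(2) d_def by (simp add: algebra_simps)
      then show ?thesis using disj [OF S(1)] by simp
    qed
  qed blast
  show ?thesis
  proof
    show "H \<in> effects (dbl V)" "\<epsilon> > 0" by (fact H)+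
    fix S assume S: "S \<in> A"
    have "qtr (dbl V) (qmult (dbl V) H (choi V (d S))) = of_real \<sigma> *
      (qtr (dbl V) (qmult (dbl V) H (choi V S)) - qtr (dbl V) (qmult (dbl V) H (choi V T)))"
      unfolding qtr_qmult_diff_right [symmetric]
      by (simp add: qtr_qmult choi_d sum_distrib_left mult_ac)
    then show "\<epsilon> \<le> \<sigma> * (Re (qtr (dbl V) (qmult (dbl V) H (choi V S)))
        - Re (qtr (dbl V) (qmult (dbl V) H (choi V T))))"
      using sep [of "d S"] S by simp
  qed
qed

subsection \<open>Completeness\<close>

lemma qtr_ext_op_complement:
  assumes "finite X" "W \<subseteq> X"
  shows "qtr X (qmult X (ext_op W X (\<lambda>p. qid W p - M p)) \<rho>)
    = qtr X \<rho> - qtr X (qmult X (ext_op W X M) \<rho>)"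
  using assms finite_subset [OF assms(2,1)]
  by (simp add: qtr_ext_op qtr_qmult_diff_left qtr_qmult_qid qtr_ptr)

lemma refine_T_imp_smyth:
  assumes V: "finite V" and A: "A \<in> NProg V" and B: "B \<in> NProg V" and ref: "refine_T V A B"
  shows "smyth V A B"
  unfolding smyth_def
proof (rule ballI, rule ccontr)
  fix T assume T: "T \<in> B" and no: "\<not> (\<exists>S\<in>A. sle V S T)"
  note NA = NProg_D [OF A] and NB = NProg_D [OF B]
  let ?W = "dbl V"
  have W: "finite ?W" "V \<subseteq> ?W" "?W \<subseteq> ?W" using V subset_dbl by auto
  have TD: "T \<in> DProg V" using T NB by blast
  obtain H \<epsilon> where H: "H \<in> effects ?W" "\<epsilon> > 0" and sep: "\<And>S. S \<in> A \<Longrightarrow>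
      \<epsilon> \<le> 1 * (Re (qtr ?W (qmult ?W H (choi V S))) - Re (qtr ?W (qmult ?W H (choi V T))))"
    using NProg_separation [OF V A TD, of 1] no by (auto simp: sle_def)
  have wfH: "wf_op ?W H" using H(1) by (simp add: effects_def psd_def)
  obtain r where r: "r > 0" "(\<lambda>p. of_real r * omega V p) \<in> dens ?W"
    using psd_normalize [OF W(1) psd_omega] .
  let ?\<rho> = "\<lambda>p. of_real r * omega V p"
  \<comment> \<open>One weakest precondition of \<open>H\<close> for each \<open>S\<close> in
    \<open>A\<close>; the demonic infimum lies below each of them, so every \<open>S\<close> meets
    the specification.\<close>
  let ?\<Theta> = "(\<lambda>S. heis V ?W S H) ` A" and ?\<Psi> = "{H}"
  have \<Theta>: "?\<Theta> \<subseteq> effects ?W" using heis_effect [OF W(1,2) _ H(1)] NA by blast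
  have \<Psi>: "?\<Psi> \<subseteq> effects ?W" using H by simp
  have "models_tot V A ?W ?\<Theta> ?\<Psi>"
    unfolding models_tot_iff [OF NA(1,2) \<Psi>]
  proof (intro allI impI ballI)
    fix X \<rho> S assume X: "finite X \<and> V \<union> ?W \<subseteq> X" and \<rho>: "\<rho> \<in> dens X" and S: "S \<in> A"
    then have *: "finite X" "?W \<subseteq> X" "psd X \<rho>" by (auto simp: dens_def)
    show "exp_dem ?W X \<rho> ?\<Theta> \<le> exp_dem ?W X (sapp V X S \<rho>) ?\<Psi>"
      using exp_dem_lower [OF *(1,2) \<Theta> *(3) imageI [OF S]] qtr_ext_op_heis [OF *(1) W(2) *(2)]
      by (simp add: exp_dem_def)
  qed
  then have "models_tot V B ?W ?\<Theta> ?\<Psi>"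
    using ref W(1) \<Theta> \<Psi> unfolding refine_T_def by blast
  then have "exp_dem ?W ?W ?\<rho> ?\<Theta> \<le> exp_dem ?W ?W (sapp V ?W T ?\<rho>) ?\<Psi>"
    unfolding models_tot_iff [OF NB(1,2) \<Psi>] using W r(2) T by blast
  also have "\<dots> = r * Re (qtr ?W (qmult ?W H (choi V T)))"
    using wfH by (simp add: exp_dem_def ext_op_self sapp_scale_right choi_def qtr_qmult sum_distrib_left mult_ac)
  also have "\<dots> < r * (Re (qtr ?W (qmult ?W H (choi V T))) + \<epsilon>)"
    using r(1) H(2) by simp
  \<comment> \<open>The uniform gap \<open>\<epsilon>\<close> survives the infimum over
    \<open>A\<close>; a strict inequality for each \<open>S\<close> alone would not.\<close>
  also have "\<dots> \<le> exp_dem ?W ?W ?\<rho> ?\<Theta>"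
  proof -
    have "r * (Re (qtr ?W (qmult ?W H (choi V T))) + \<epsilon>)
        \<le> Re (qtr ?W (qmult ?W (ext_op ?W ?W (heis V ?W S H)) ?\<rho>))" if "S \<in> A" for S
    proof -
      have "Re (qtr ?W (qmult ?W (ext_op ?W ?W (heis V ?W S H)) ?\<rho>))
          = r * Re (qtr ?W (qmult ?W H (choi V S)))"
        unfolding qtr_ext_op_heis [OF W]
        using wfH by (simp add: ext_op_self sapp_scale_right choi_def qtr_qmult sum_distrib_left mult_ac)
      then show ?thesis using sep [OF that] r(1) by simp
    qed
    then show ?thesis
      using NA(1) unfolding exp_dem_def by (auto intro!: cINF_greatest)
  qed
  finally show False by simp
qed

lemma refine_P_imp_hoare:
  assumes V: "finite V" and A: "A \<in> NProg V" and B: "B \<in> NProg V" and ref: "refine_P V A B"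
  shows "hoare V B A"
  unfolding hoare_def
proof (rule ballI, rule ccontr)
  fix T assume T: "T \<in> B" and no: "\<not> (\<exists>S\<in>A. sle V T S)"
  note NA = NProg_D [OF A] and NB = NProg_D [OF B]
  let ?W = "dbl V"
  have W: "finite ?W" "V \<subseteq> ?W" "?W \<subseteq> ?W" using V subset_dbl by auto
  have TD: "T \<in> DProg V" using T NB by blast
  obtain H \<epsilon> where H: "H \<in> effects ?W" "\<epsilon> > 0" and sep: "\<And>S. S \<in> A \<Longrightarrow>
      \<epsilon> \<le> (-1) * (Re (qtr ?W (qmult ?W H (choi V S))) - Re (qtr ?W (qmult ?W H (choi V T))))"
    using NProg_separation [OF V A TD, of "-1"] no by (auto simp: sle_def)
  have wfH: "wf_op ?W H" using H(1) by (simp add: effects_def psd_def)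
  obtain r where r: "r > 0" "(\<lambda>p. of_real r * omega V p) \<in> dens ?W"
    using psd_normalize [OF W(1) psd_omega] .
  let ?\<rho> = "\<lambda>p. of_real r * omega V p"
  \<comment> \<open>Complements are weakest liberal preconditions: the expectation of the complement
    of \<open>H\<close> in the output plus the lost trace equals the expectation in
    \<open>\<rho>\<close> of the complement of the adjoint.\<close>
  let ?\<Theta> = "(\<lambda>S p. qid ?W p - heis V ?W S H p) ` A" and ?\<Psi> = "{\<lambda>p. qid ?W p - H p}"
  have \<Theta>: "?\<Theta> \<subseteq> effects ?W"
    using effects_complement [OF heis_effect [OF W(1,2) _ H(1)]] NA by blast
  have \<Psi>: "?\<Psi> \<subseteq> effects ?W" using effects_complement [OF H(1)] by simp
  have "models_par V A ?W ?\<Theta> ?\<Psi>"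
    unfolding models_par_iff [OF NA(1,2) \<Psi>]
  proof (intro allI impI ballI)
    fix X \<rho> S assume X: "finite X \<and> V \<union> ?W \<subseteq> X" and \<rho>: "\<rho> \<in> dens X" and S: "S \<in> A"
    then have *: "finite X" "?W \<subseteq> X" "psd X \<rho>" by (auto simp: dens_def)
    show "exp_dem ?W X \<rho> ?\<Theta> \<le> exp_dem ?W X (sapp V X S \<rho>) ?\<Psi> + Re (qtr X \<rho>) - Re (qtr X (sapp V X S \<rho>))"
      using exp_dem_lower [OF *(1,2) \<Theta> *(3) imageI [OF S]] qtr_ext_op_heis [OF *(1) W(2) *(2)]
      by (simp add: exp_dem_def qtr_ext_op_complement [OF *(1,2)])
  qed
  then have "models_par V B ?W ?\<Theta> ?\<Psi>"
    using ref W(1) \<Theta> \<Psi> unfolding refine_P_def by blast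
  then have "exp_dem ?W ?W ?\<rho> ?\<Theta>
      \<le> exp_dem ?W ?W (sapp V ?W T ?\<rho>) ?\<Psi> + Re (qtr ?W ?\<rho>) - Re (qtr ?W (sapp V ?W T ?\<rho>))"
    unfolding models_par_iff [OF NB(1,2) \<Psi>] using W r(2) T by blast
  also have "\<dots> = Re (qtr ?W ?\<rho>) - Re (qtr ?W (qmult ?W H (sapp V ?W T ?\<rho>)))"
    using wfH by (simp add: exp_dem_def qtr_ext_op_complement [OF W(1,3)] ext_op_self)
  also have "Re (qtr ?W (qmult ?W H (sapp V ?W T ?\<rho>))) = r * Re (qtr ?W (qmult ?W H (choi V T)))"
    by (simp add: sapp_scale_right choi_def qtr_qmult sum_distrib_left mult_ac)
  also have "Re (qtr ?W ?\<rho>) - \<dots> < Re (qtr ?W ?\<rho>) - r * (Re (qtr ?W (qmult ?W H (choi V T))) - \<epsilon>)"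
    using r(1) H(2) by simp
  also have "\<dots> \<le> exp_dem ?W ?W ?\<rho> ?\<Theta>"
  proof -
    have "Re (qtr ?W ?\<rho>) - r * (Re (qtr ?W (qmult ?W H (choi V T))) - \<epsilon>)
        \<le> Re (qtr ?W (qmult ?W (ext_op ?W ?W (\<lambda>p. qid ?W p - heis V ?W S H p)) ?\<rho>))" if "S \<in> A" for S
    proof -
      have "Re (qtr ?W (qmult ?W (ext_op ?W ?W (heis V ?W S H)) ?\<rho>))
          = r * Re (qtr ?W (qmult ?W H (choi V S)))"
        unfolding qtr_ext_op_heis [OF W]
        using wfH by (simp add: ext_op_self sapp_scale_right choi_def qtr_qmult sum_distrib_left mult_ac)
      then show ?thesis using sep [OF that] r(1) by (simp add: qtr_ext_op_complement [OF W(1,3)])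
    qed
    then show ?thesis
      using NA(1) unfolding exp_dem_def by (auto intro!: cINF_greatest)
  qed
  finally show False by simp
qed

section \<open>Orders as inclusions of closures, and the assembled characterisations\<close>

lemma smyth_iff_upc:
  assumes "A \<subseteq> DProg V" "B \<subseteq> DProg V"
  shows "smyth V A B \<longleftrightarrow> upc V B \<subseteq> upc V A"
proof
  show "smyth V A B \<Longrightarrow> upc V B \<subseteq> upc V A"
    unfolding smyth_def upc_def using sle_trans by blast
  show "upc V B \<subseteq> upc V A \<Longrightarrow> smyth V A B"
    unfolding smyth_def upc_def using assms sle_refl by blast
qed

lemma hoare_iff_downc:
  assumes "A \<subseteq> DProg V" "B \<subseteq> DProg V"
  shows "hoare V A B \<longleftrightarrow> downc V A \<subseteq> downc V B"
proof
  show "hoare V A B \<Longrightarrow> downc V A \<subseteq> downc V B"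
    unfolding hoare_def downc_def using sle_trans by blast
  show "downc V A \<subseteq> downc V B \<Longrightarrow> hoare V A B"
    unfolding hoare_def downc_def using assms sle_refl by blast
qed

theorem theorem5p1:
  fixes V :: "nat set" and E F :: "sop set"
  assumes "finite V" and "E \<in> NProg V" and "F \<in> NProg V"
  shows "((refine_T V E F \<longleftrightarrow> smyth V E F) \<and> (smyth V E F \<longleftrightarrow> upc V F \<subseteq> upc V E))
     \<and> ((refine_P V E F \<longleftrightarrow> hoare V F E) \<and> (hoare V F E \<longleftrightarrow> downc V F \<subseteq> downc V E))
     \<and> (egli_milner V E F \<longleftrightarrow> refine_T V E F \<and> refine_P V F E)
     \<and> ((equiv_T V E F \<longleftrightarrow> upc V E = upc V F) \<and> (equiv_P V E F \<longleftrightarrow> downc V E = downc V F))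
     \<and> ((\<forall>S\<in>E. trace_pres V S) \<and> (\<forall>S\<in>F. trace_pres V S) \<longrightarrow>
         (refine_T V E F \<longleftrightarrow> refine_P V E F) \<and> (refine_P V E F \<longleftrightarrow> F \<subseteq> E))"
proof -
  \<comment> \<open>Stated for arbitrary \<open>A\<close> and \<open>B\<close>, since the
    Egli-Milner order and the kernels need both directions of refinement.\<close>
  have T: "refine_T V A B \<longleftrightarrow> smyth V A B" "smyth V A B \<longleftrightarrow> upc V B \<subseteq> upc V A"
    and P: "refine_P V A B \<longleftrightarrow> hoare V B A" "hoare V B A \<longleftrightarrow> downc V B \<subseteq> downc V A"
    if "A \<in> NProg V" "B \<in> NProg V" for A B
    using smyth_imp_refine_T [OF that] refine_T_imp_smyth [OF assms(1) that]
      hoare_imp_refine_P [OF that] refine_P_imp_hoare [OF assms(1) that]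
      smyth_iff_upc [of A V B] hoare_iff_downc [of B V A] that [THEN NProg_D(2)] by blast+
  have "smyth V E F \<longleftrightarrow> F \<subseteq> E" "hoare V F E \<longleftrightarrow> F \<subseteq> E"
    if "\<forall>S\<in>E. trace_pres V S" "\<forall>S\<in>F. trace_pres V S"
  proof -
    have *: "S \<in> DProg V" "trace_pres V S" if "S \<in> E \<union> F" for S
      using that NProg_D(2) [OF assms(2)] NProg_D(2) [OF assms(3)]
        \<open>\<forall>S\<in>E. trace_pres V S\<close> \<open>\<forall>S\<in>F. trace_pres V S\<close> by blast+
    \<comment> \<open>Among trace-preserving maps the order is equality, so Smyth and Hoare
      domination both reduce to the inclusion of \<open>F\<close> in \<open>E\<close>.\<close>
    have eq: "S = S'" if "S \<in> E \<union> F" "S' \<in> E \<union> F" "sle V S S'" for S S'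
      using that by (intro trace_pres_sle_eq [OF assms(1)] *)
    show "smyth V E F \<longleftrightarrow> F \<subseteq> E"
      unfolding smyth_def using eq sle_refl by blast
    show "hoare V F E \<longleftrightarrow> F \<subseteq> E"
      unfolding hoare_def using eq sle_refl by blast
  qed
  then show ?thesis
    using T [OF assms(2,3)] T [OF assms(3,2)] P [OF assms(2,3)] P [OF assms(3,2)]
    unfolding egli_milner_def equiv_T_def equiv_P_def by blast
qed

end
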